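(* Let $\mathbb{C}$ be a strict Markov category and $\theta\colon \mathrm{Var}\to\mathrm{ob}(\mathbb{C})$ any function. Then the tuple $\langle \mathrm{Ker}(\mathbb{C}_\theta), \sqsubseteq, \oplus, \odot, \mathrm{Ker}(\mathbb{C}_\theta)\rangle$ (state set, preorder, parallel composition, sequential composition, and set of units equal to the whole state set) is a DIBI frame.
   Context: Fix a countably infinite set $\mathrm{Var}$ of variables with a strict linear order $\prec$. For a finite set $S\subseteq\mathrm{Var}$, $[S]$ denotes the $\prec$-increasing list of its elements. A (strict) Markov category $(\mathbb{C},\otimes,\mathsf I)$ is a strict symmetric monoidal category (symmetries $\sigma_{A,B}$) in which every object $A$ carries morphisms $\mathsf{copy}_A\colon A\to A\otimes A$ and $\mathsf{del}_A\colon A\to \mathsf I$ forming a commutative comonoid, compatible with the monoidal structure ($\mathsf{copy}_{A\otimes B}=(\mathrm{id}_A\otimes\sigma_{A,B}\otimes\mathrm{id}_B)\circ(\mathsf{copy}_A\otimes\mathsf{copy}_B)$, $\mathsf{del}_{A\otimes B}=\mathsf{del}_A\otimes\mathsf{del}_B$), and such that $\mathsf{del}$ is natural: $\mathsf{del}_B\circ f=\mathsf{del}_A$ for all $f\colon A\to B$. Given $\theta\colon\mathrm{Var}\to\mathrm{ob}(\mathbb{C})$, the category $\mathbb{C}_\theta$ has as objects all finite lists of variables; a morphism $[x_1,\dots,x_m]\to[y_1,\dots,y_n]$ is a $\mathbb{C}$-morphism $\theta(x_1)\otimes\cdots\otimes\theta(x_m)\to\theta(y_1)\otimes\cdots\otimes\theta(y_n)$;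 composition and identities are those of $\mathbb{C}$; the monoidal product is list concatenation on objects and $\otimes$ on morphisms; copy and delete on a list $K$ (written $\mathsf{copy}_K,\mathsf{del}_K$) are those of $\mathbb{C}$ at the corresponding tensor object. A rewiring is a morphism built only from identities and symmetries, from a list to a permutation of it, permuting the tensor factors according to the permutation of variables. A $\mathbb{C}_\theta$-kernel (input-preserving kernel), written $f\colon X\to Y$ for finite sets $X\subseteq Y$, is a $\mathbb{C}_\theta$-morphism $f\colon[X]\to[Y]$ of the form $f=\sigma\circ(\mathrm{id}_{[X]}\otimes f')\circ\mathsf{copy}_{[X]}$ for some $\mathbb{C}_\theta$-morphism $f'\colon[X]\to[Y\setminus X]$ (its nontrivial part) and the rewiring $\sigma\colon[X][Y\setminus X]\to[Y]$. $\mathrm{Ker}(\mathbb{C}_\theta)$ is the set of all such kernels. Sequential composition: for kernels $f\colon X\to Y$, $g\colon U\to V$, $f\odot g$ is defined iff $Y=U$, and then $f\odot g=g\circ f$. Parallel composition: with nontrivial parts $f',g'$, $f\oplus g$ is defined iff $X\cap U=Y\cap V$; then, with $L=[X\cap U]$, $L_1=[X\setminus U]$, $L_2=[U\setminus X]$, $f\oplus g\colon X\cup U\to Y\cup V$ is $\sigma_2\circ(\mathrm{id}_{L_1L L_2}\otimes (f'\circ\rho_1)\otimes(g'\circ\rho_2))\circ(\mathrm{id}_{L_1LL_2}\otimes\mathrm{id}_{L_1}\otimes\mathsf{copy}_L\otimes\mathrm{id}_{L_2})\circ\mathsf{copy}_{L_1LL_2}\circ\sigma_1$, where $\sigma_1\colon[X\cup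 U]\to L_1LL_2$, $\rho_1\colon L_1L\to[X]$, $\rho_2\colon LL_2\to[U]$, $\sigma_2\colon L_1LL_2[Y\setminus X][V\setminus U]\to[Y\cup V]$ are rewirings. Subkernel: $f\sqsubseteq g$ (for kernels $f\colon X\to Y$, $g$) iff there exist a finite set $Z\subseteq\mathrm{Var}$ of variables not in $Y$, a kernel $h$ and rewirings $\sigma_1\colon[X\cup Z]\to[X][Z]$, $\sigma_2\colon[Y][Z]\to[Y\cup Z]$ with $g=h\circ\sigma_2\circ(f\otimes\mathrm{id}_{[Z]})\circ\sigma_1$. A DIBI frame is a tuple $\langle A,\sqsubseteq,\oplus,\odot,E\rangle$ with $A$ a set, $\sqsubseteq$ a preorder on $A$, $E\subseteq A$, and $\oplus,\odot$ partial binary operations on $A$, satisfying (all variables universally quantified; $\downarrow$ = "is defined"; $\doteq$ = "equal whenever either side is defined"): $a\oplus b\doteq b\oplus a$; $\exists e\in E.\,a=e\oplus a$; $(a\oplus b)\oplus c\doteq a\oplus(b\oplus c)$; $\exists e\in E.\,a=e\odot a$; $\exists e\in E.\,a=a\odot e$; $(a\odot b)\odot c\doteq a\odot(b\odot c)$; $e\in E$ and $(a\oplus e)\downarrow$ imply $a\oplus e\sqsupseteq a$; $e\in E$ and $(a\odot e)\downarrow$ imply $a\odot e\sqsupseteq a$; $e\in E$ and $e'\sqsupseteq e$ imply $e'\in E$; $(a\oplus b)\downarrow$, $a\sqsupseteq a'$, $b\sqsupseteq b'$ imply $(a'\oplus b')\downarrow$ and $a\oplus b\sqsupseteq a'\oplus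 b'$; $(a\odot b)\downarrow$ and $a\odot b\sqsubseteq c'$ imply there are $a'\sqsupseteq a$, $b'\sqsupseteq b$ with $c'=a'\odot b'$; $(a_1\odot a_2)\oplus(b_1\odot b_2)\doteq(a_1\oplus b_1)\odot(a_2\oplus b_2)$.
   Formalization: The reverse exchange law (a₁⊙a₂)⊕(b₁⊙b₂) ≐ (a₁⊕b₁)⊙(a₂⊕b₂) is required only when a₁⊙a₂ and b₁⊙b₂ are defined; unguarded it fails for a₁=b₂=id on {x}, a₂=b₁=id on {y}, x≠y, where only the right side is defined. *)

theory Defs
  imports Main "HOL-Library.Countable_Set"
begin

section \<open>Strict Markov categories\<close>

record ('o, 'm) markov_data =
  Obj :: "'o set"
  Arr :: "'m set"
  Dom :: "'m \<Rightarrow> 'o"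
  Cod :: "'m \<Rightarrow> 'o"
  Id :: "'o \<Rightarrow> 'm"
  Comp :: "'m \<Rightarrow> 'm \<Rightarrow> 'm" (infixr "\<cdot>\<index>" 55)
  TensObj :: "'o \<Rightarrow> 'o \<Rightarrow> 'o" (infixr "\<boxtimes>\<index>" 70)
  Tens :: "'m \<Rightarrow> 'm \<Rightarrow> 'm" (infixr "\<otimes>\<index>" 70)
  Unit :: "'o"
  Sym :: "'o \<Rightarrow> 'o \<Rightarrow> 'm"
  Copy :: "'o \<Rightarrow> 'm"
  Del :: "'o \<Rightarrow> 'm"

text \<open>Composition is written in applicative order: \<open>g \<cdot> f\<close> is \<open>g\<close> after \<open>f\<close>.\<close>

definition Hom :: "('o, 'm, 'z) markov_data_scheme \<Rightarrow> 'o \<Rightarrow> 'o \<Rightarrow> 'm set" where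
  "Hom C A B = {f \<in> Arr C. Dom C f = A \<and> Cod C f = B}"

locale category =
  fixes C :: "('o, 'm, 'z) markov_data_scheme" (structure)
  assumes Dom_Obj: "f \<in> Arr C \<Longrightarrow> Dom C f \<in> Obj C"
    and Cod_Obj: "f \<in> Arr C \<Longrightarrow> Cod C f \<in> Obj C"
    and Id_Hom: "A \<in> Obj C \<Longrightarrow> Id C A \<in> Hom C A A"
    and Comp_Hom: "f \<in> Hom C A B \<Longrightarrow> g \<in> Hom C B D \<Longrightarrow> g \<cdot> f \<in> Hom C A D"
    and Comp_Id: "f \<in> Hom C A B \<Longrightarrow> f \<cdot> Id C A = f"
    and Id_Comp: "f \<in> Hom C A B \<Longrightarrow> Id C B \<cdot> f = f"
    and Comp_assoc:
      "f \<in> Hom C A B \<Longrightarrow> g \<in> Hom C B D \<Longrightarrow> h \<in> Hom C D F \<Longrightarrow> (h \<cdot> g) \<cdot> f = h \<cdot> (g \<cdot> f)"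

text \<open>The unit coherence \<open>Sym A Unit = Id A\<close> follows from the hexagon and invertibility.\<close>

locale strict_symmetric_monoidal_category = category +
  assumes Unit_Obj: "Unit C \<in> Obj C"
    and TensObj_Obj: "A \<in> Obj C \<Longrightarrow> B \<in> Obj C \<Longrightarrow> A \<boxtimes> B \<in> Obj C"
    and TensObj_assoc:
      "A \<in> Obj C \<Longrightarrow> B \<in> Obj C \<Longrightarrow> D \<in> Obj C \<Longrightarrow> (A \<boxtimes> B) \<boxtimes> D = A \<boxtimes> (B \<boxtimes> D)"
    and TensObj_Unit: "A \<in> Obj C \<Longrightarrow> A \<boxtimes> Unit C = A"
    and Unit_TensObj: "A \<in> Obj C \<Longrightarrow> Unit C \<boxtimes> A = A"
    and Tens_Hom: "f \<in> Hom C A B \<Longrightarrow> g \<in> Hom C A' B' \<Longrightarrow> f \<otimes> g \<in> Hom C (A \<boxtimes> A') (B \<boxtimes> B')"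
    and Tens_Id: "A \<in> Obj C \<Longrightarrow> B \<in> Obj C \<Longrightarrow> Id C A \<otimes> Id C B = Id C (A \<boxtimes> B)"
    and Tens_Comp:
      "f \<in> Hom C A B \<Longrightarrow> g \<in> Hom C B D \<Longrightarrow> f' \<in> Hom C A' B' \<Longrightarrow> g' \<in> Hom C B' D' \<Longrightarrow>
        (g \<cdot> f) \<otimes> (g' \<cdot> f') = (g \<otimes> g') \<cdot> (f \<otimes> f')"
    and Tens_assoc:
      "f \<in> Arr C \<Longrightarrow> g \<in> Arr C \<Longrightarrow> h \<in> Arr C \<Longrightarrow> (f \<otimes> g) \<otimes> h = f \<otimes> (g \<otimes> h)"
    and Tens_Unit: "f \<in> Arr C \<Longrightarrow> f \<otimes> Id C (Unit C) = f"
    and Unit_Tens: "f \<in> Arr C \<Longrightarrow> Id C (Unit C) \<otimes> f = f"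
    and Sym_Hom: "A \<in> Obj C \<Longrightarrow> B \<in> Obj C \<Longrightarrow> Sym C A B \<in> Hom C (A \<boxtimes> B) (B \<boxtimes> A)"
    and Sym_natural:
      "f \<in> Hom C A B \<Longrightarrow> g \<in> Hom C A' B' \<Longrightarrow>
        Sym C B B' \<cdot> (f \<otimes> g) = (g \<otimes> f) \<cdot> Sym C A A'"
    and Sym_Sym: "A \<in> Obj C \<Longrightarrow> B \<in> Obj C \<Longrightarrow> Sym C B A \<cdot> Sym C A B = Id C (A \<boxtimes> B)"
    and Sym_hexagon:
      "A \<in> Obj C \<Longrightarrow> B \<in> Obj C \<Longrightarrow> D \<in> Obj C \<Longrightarrow>
        Sym C A (B \<boxtimes> D) = (Id C B \<otimes> Sym C A D) \<cdot> (Sym C A B \<otimes> Id C D)"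

locale markov_category = strict_symmetric_monoidal_category +
  assumes Copy_Hom: "A \<in> Obj C \<Longrightarrow> Copy C A \<in> Hom C A (A \<boxtimes> A)"
    and Del_Hom: "A \<in> Obj C \<Longrightarrow> Del C A \<in> Hom C A (Unit C)"
    and Copy_coassoc:
      "A \<in> Obj C \<Longrightarrow> (Copy C A \<otimes> Id C A) \<cdot> Copy C A = (Id C A \<otimes> Copy C A) \<cdot> Copy C A"
    and Copy_counit_left: "A \<in> Obj C \<Longrightarrow> (Del C A \<otimes> Id C A) \<cdot> Copy C A = Id C A"
    and Copy_counit_right: "A \<in> Obj C \<Longrightarrow> (Id C A \<otimes> Del C A) \<cdot> Copy C A = Id C A"
    and Copy_commute: "A \<in> Obj C \<Longrightarrow> Sym C A A \<cdot> Copy C A = Copy C A"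
    and Copy_TensObj:
      "A \<in> Obj C \<Longrightarrow> B \<in> Obj C \<Longrightarrow>
        Copy C (A \<boxtimes> B) = (Id C A \<otimes> Sym C A B \<otimes> Id C B) \<cdot> (Copy C A \<otimes> Copy C B)"
    and Del_TensObj: "A \<in> Obj C \<Longrightarrow> B \<in> Obj C \<Longrightarrow> Del C (A \<boxtimes> B) = Del C A \<otimes> Del C B"
    and Del_natural: "f \<in> Hom C A B \<Longrightarrow> Del C B \<cdot> f = Del C A"


section \<open>The category of lists of variables\<close>

definition tens_list :: "('o, 'm, 'z) markov_data_scheme \<Rightarrow> ('v \<Rightarrow> 'o) \<Rightarrow> 'v list \<Rightarrow> 'o" where
  "tens_list C \<theta> K = foldr (\<lambda>x A. TensObj C (\<theta> x) A) K (Unit C)"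

text \<open>
  A morphism is tagged with its source and target lists, since \<open>\<theta>\<close> may identify different lists.
\<close>

definition var_category ::
  "('o, 'm, 'z) markov_data_scheme \<Rightarrow> ('v \<Rightarrow> 'o) \<Rightarrow> ('v list, 'v list \<times> 'v list \<times> 'm) markov_data"
where
  "var_category C \<theta> = \<lparr>
    Obj = UNIV,
    Arr = {(K, L, f) | K L f. f \<in> Hom C (tens_list C \<theta> K) (tens_list C \<theta> L)},
    Dom = (\<lambda>(K, L, f). K),
    Cod = (\<lambda>(K, L, f). L),
    Id = (\<lambda>K. (K, K, Id C (tens_list C \<theta> K))),
    Comp = (\<lambda>(L', M, g) (K, L, f). (K, M, Comp C g f)),
    TensObj = (@),
    Tens = (\<lambda>(K, L, f) (K', L', f'). (K @ K', L @ L', Tens C f f')),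
    Unit = [],
    Sym = (\<lambda>K L. (K @ L, L @ K, Sym C (tens_list C \<theta> K) (tens_list C \<theta> L))),
    Copy = (\<lambda>K. (K, K @ K, Copy C (tens_list C \<theta> K))),
    Del = (\<lambda>K. (K, [], Del C (tens_list C \<theta> K)))\<rparr>"


section \<open>Rewirings and kernels\<close>

text \<open>
  Below, \<open>D\<close> stands for \<open>var_category C \<theta>\<close>. Its symmetries act on the lists as block transpositions,
  so the source and target lists of a rewiring record how the tensor factors are permuted. For lists
  without repetitions the rewiring between them is unique by coherence.
\<close>

inductive_set rewirings :: "('v list, 'm) markov_data \<Rightarrow> 'm set"
  for D :: "('v list, 'm) markov_data" (structure) where
  Id: "K \<in> Obj D \<Longrightarrow> Id D K \<in> rewirings D"
| Sym: "K \<in> Obj D \<Longrightarrow> L \<in> Obj D \<Longrightarrow> Sym D K L \<in> rewirings D"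
| Comp: "s \<in> rewirings D \<Longrightarrow> t \<in> rewirings D \<Longrightarrow> Cod D s = Dom D t \<Longrightarrow> t \<cdot> s \<in> rewirings D"
| Tens: "s \<in> rewirings D \<Longrightarrow> t \<in> rewirings D \<Longrightarrow> s \<otimes> t \<in> rewirings D"

definition is_rewiring :: "('v list, 'm) markov_data \<Rightarrow> 'v list \<Rightarrow> 'v list \<Rightarrow> 'm \<Rightarrow> bool" where
  "is_rewiring D K L s \<longleftrightarrow> s \<in> rewirings D \<and> Dom D s = K \<and> Cod D s = L"

definition rewire :: "('v list, 'm) markov_data \<Rightarrow> 'v list \<Rightarrow> 'v list \<Rightarrow> 'm" where
  "rewire D K L = (THE s. is_rewiring D K L s)"

abbreviation (input) lst :: "'v::linorder set \<Rightarrow> 'v list" where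
  "lst S \<equiv> sorted_list_of_set S"

definition kernel_of ::
  "('v::linorder list, 'm) markov_data \<Rightarrow> 'v set \<Rightarrow> 'v set \<Rightarrow> 'm \<Rightarrow> 'm" where
  "kernel_of D X Y f' =
    rewire D (lst X @ lst (Y - X)) (lst Y) \<cdot> (Id D (lst X) \<otimes> f') \<cdot> Copy D (lst X)" for D (structure)

definition is_kernel ::
  "('v::linorder list, 'm) markov_data \<Rightarrow> 'v set \<Rightarrow> 'v set \<Rightarrow> 'm \<Rightarrow> bool" where
  "is_kernel D X Y f \<longleftrightarrow>
    finite X \<and> finite Y \<and> X \<subseteq> Y \<and>
    (\<exists>f' \<in> Hom D (lst X) (lst (Y - X)). f = kernel_of D X Y f')"

definition Ker :: "('v::linorder list, 'm) markov_data \<Rightarrow> 'm set" where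
  "Ker D = {f. \<exists>X Y. is_kernel D X Y f}"

definition src :: "('v list, 'm) markov_data \<Rightarrow> 'm \<Rightarrow> 'v set" where
  "src D f = set (Dom D f)"

definition tgt :: "('v list, 'm) markov_data \<Rightarrow> 'm \<Rightarrow> 'v set" where
  "tgt D f = set (Cod D f)"

text \<open>The nontrivial part is unique: it is recovered by deleting the copy of the input.\<close>

definition nontrivial_part :: "('v::linorder list, 'm) markov_data \<Rightarrow> 'm \<Rightarrow> 'm" where
  "nontrivial_part D f =
    (THE f'. f' \<in> Hom D (lst (src D f)) (lst (tgt D f - src D f)) \<and>
      f = kernel_of D (src D f) (tgt D f) f')"

definition seq_comp :: "('v list, 'm) markov_data \<Rightarrow> 'm \<Rightarrow> 'm \<Rightarrow> 'm option" where
  "seq_comp D f g = (if tgt D f = src D g then Some (g \<cdot> f) else None)" for D (structure)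

definition par_comp :: "('v::linorder list, 'm) markov_data \<Rightarrow> 'm \<Rightarrow> 'm \<Rightarrow> 'm option" where
  "par_comp D f g =
    (let X = src D f; Y = tgt D f; U = src D g; V = tgt D g;
         f' = nontrivial_part D f; g' = nontrivial_part D g;
         L = lst (X \<inter> U); L\<^sub>1 = lst (X - U); L\<^sub>2 = lst (U - X);
         K = L\<^sub>1 @ L @ L\<^sub>2;
         \<sigma>\<^sub>1 = rewire D (lst (X \<union> U)) K;
         \<rho>\<^sub>1 = rewire D (L\<^sub>1 @ L) (lst X);
         \<rho>\<^sub>2 = rewire D (L @ L\<^sub>2) (lst U);
         \<sigma>\<^sub>2 = rewire D (K @ lst (Y - X) @ lst (V - U)) (lst (Y \<union> V))
     in if X \<inter> U = Y \<inter> V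
        then Some (\<sigma>\<^sub>2 \<cdot> (Id D K \<otimes> (f' \<cdot> \<rho>\<^sub>1) \<otimes> (g' \<cdot> \<rho>\<^sub>2))
          \<cdot> (Id D K \<otimes> Id D L\<^sub>1 \<otimes> Copy D L \<otimes> Id D L\<^sub>2) \<cdot> Copy D K \<cdot> \<sigma>\<^sub>1)
        else None)" for D (structure)

definition subkernel :: "('v::linorder list, 'm) markov_data \<Rightarrow> 'm \<Rightarrow> 'm \<Rightarrow> bool" where
  "subkernel D f g \<longleftrightarrow>
    f \<in> Ker D \<and> g \<in> Ker D \<and>
    (\<exists>Z h \<sigma>\<^sub>1 \<sigma>\<^sub>2.
      finite Z \<and> Z \<inter> tgt D f = {} \<and> h \<in> Ker D \<and> src D h = tgt D f \<union> Z \<and>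
      is_rewiring D (lst (src D f \<union> Z)) (lst (src D f) @ lst Z) \<sigma>\<^sub>1 \<and>
      is_rewiring D (lst (tgt D f) @ lst Z) (lst (tgt D f \<union> Z)) \<sigma>\<^sub>2 \<and>
      g = h \<cdot> \<sigma>\<^sub>2 \<cdot> (f \<otimes> Id D (lst Z)) \<cdot> \<sigma>\<^sub>1)" for D (structure)


section \<open>DIBI frames\<close>

text \<open>
  Partial operations return options. With strict lifting to partial arguments, equality of options
  is the relation \<open>\<doteq>\<close>: if either side is defined then so is the other, and they are equal.
\<close>

definition lift_partial ::
  "('a \<Rightarrow> 'a \<Rightarrow> 'a option) \<Rightarrow> 'a option \<Rightarrow> 'a option \<Rightarrow> 'a option" where
  "lift_partial m x y = Option.bind x (\<lambda>a. Option.bind y (\<lambda>b. m a b))"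

text \<open>
  Reverse exchange carries the guard that \<open>a\<^sub>1 \<odot> a\<^sub>2\<close> and \<open>b\<^sub>1 \<odot> b\<^sub>2\<close> are defined. Without it the law fails
  for kernels whenever there are two variables \<open>x \<noteq> y\<close>: for \<open>a\<^sub>1 = b\<^sub>2 = id\<close> on \<open>{x}\<close> and
  \<open>a\<^sub>2 = b\<^sub>1 = id\<close> on \<open>{y}\<close>, the composite \<open>(a\<^sub>1 \<oplus> b\<^sub>1) \<odot> (a\<^sub>2 \<oplus> b\<^sub>2)\<close> is defined but \<open>a\<^sub>1 \<odot> a\<^sub>2\<close> is not.
  The guarded law still says that the right-hand side is defined and equal to the left-hand side
  whenever the latter is defined.
\<close>

locale dibi_frame =
  fixes A :: "'a set"
    and le :: "'a \<Rightarrow> 'a \<Rightarrow> bool" (infix "\<sqsubseteq>" 50)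
    and par :: "'a \<Rightarrow> 'a \<Rightarrow> 'a option" (infixl "\<oplus>" 65)
    and seq :: "'a \<Rightarrow> 'a \<Rightarrow> 'a option" (infixl "\<odot>" 65)
    and E :: "'a set"
  assumes le_refl: "reflp_on A (\<sqsubseteq>)"
    and le_trans: "transp_on A (\<sqsubseteq>)"
    and E_subset: "E \<subseteq> A"
    and par_closed: "a \<in> A \<Longrightarrow> b \<in> A \<Longrightarrow> a \<oplus> b = Some c \<Longrightarrow> c \<in> A"
    and seq_closed: "a \<in> A \<Longrightarrow> b \<in> A \<Longrightarrow> a \<odot> b = Some c \<Longrightarrow> c \<in> A"
    and par_commute: "a \<in> A \<Longrightarrow> b \<in> A \<Longrightarrow> a \<oplus> b = b \<oplus> a"
    and par_unit: "a \<in> A \<Longrightarrow> \<exists>e\<in>E. e \<oplus> a = Some a"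
    and par_assoc: "a \<in> A \<Longrightarrow> b \<in> A \<Longrightarrow> c \<in> A \<Longrightarrow>
      lift_partial (\<oplus>) (a \<oplus> b) (Some c) = lift_partial (\<oplus>) (Some a) (b \<oplus> c)"
    and seq_unit_left: "a \<in> A \<Longrightarrow> \<exists>e\<in>E. e \<odot> a = Some a"
    and seq_unit_right: "a \<in> A \<Longrightarrow> \<exists>e\<in>E. a \<odot> e = Some a"
    and seq_assoc: "a \<in> A \<Longrightarrow> b \<in> A \<Longrightarrow> c \<in> A \<Longrightarrow>
      lift_partial (\<odot>) (a \<odot> b) (Some c) = lift_partial (\<odot>) (Some a) (b \<odot> c)"
    and par_unit_coherence: "e \<in> E \<Longrightarrow> a \<in> A \<Longrightarrow> a \<oplus> e = Some c \<Longrightarrow> a \<sqsubseteq> c"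
    and seq_unit_coherence: "e \<in> E \<Longrightarrow> a \<in> A \<Longrightarrow> a \<odot> e = Some c \<Longrightarrow> a \<sqsubseteq> c"
    and unit_closure: "e \<in> E \<Longrightarrow> e' \<in> A \<Longrightarrow> e \<sqsubseteq> e' \<Longrightarrow> e' \<in> E"
    and par_down_closed:
      "a \<in> A \<Longrightarrow> b \<in> A \<Longrightarrow> a' \<in> A \<Longrightarrow> b' \<in> A \<Longrightarrow> a \<oplus> b = Some c \<Longrightarrow> a' \<sqsubseteq> a \<Longrightarrow> b' \<sqsubseteq> b \<Longrightarrow>
        \<exists>c'. a' \<oplus> b' = Some c' \<and> c' \<sqsubseteq> c"
    and seq_up_closed:
      "a \<in> A \<Longrightarrow> b \<in> A \<Longrightarrow> c' \<in> A \<Longrightarrow> a \<odot> b = Some c \<Longrightarrow> c \<sqsubseteq> c' \<Longrightarrow>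
        \<exists>a'\<in>A. \<exists>b'\<in>A. a \<sqsubseteq> a' \<and> b \<sqsubseteq> b' \<and> a' \<odot> b' = Some c'"
    and reverse_exchange:
      "a\<^sub>1 \<in> A \<Longrightarrow> a\<^sub>2 \<in> A \<Longrightarrow> b\<^sub>1 \<in> A \<Longrightarrow> b\<^sub>2 \<in> A \<Longrightarrow> a\<^sub>1 \<odot> a\<^sub>2 \<noteq> None \<Longrightarrow> b\<^sub>1 \<odot> b\<^sub>2 \<noteq> None \<Longrightarrow>
        lift_partial (\<oplus>) (a\<^sub>1 \<odot> a\<^sub>2) (b\<^sub>1 \<odot> b\<^sub>2) = lift_partial (\<odot>) (a\<^sub>1 \<oplus> b\<^sub>1) (a\<^sub>2 \<oplus> b\<^sub>2)"

end

theory Submission imports Defs "HOL-Library.Multiset" begin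

text \<open>
  In a Markov category, morphisms that commute with copying (deterministic ones) into a product are
  determined by their marginals. Hence for lists \<open>K\<close>, \<open>L\<close> with \<open>set L \<subseteq> set K\<close> there is a canonical
  deterministic map \<open>sel K L\<close> from \<open>K\<close> to \<open>L\<close>, these maps compose, and on lists without repetitions all
  identities, copies, deletions and rewirings are of this form. This replaces coherence.

  A morphism \<open>f: [X] \<rightarrow> [Y]\<close> is a kernel iff copying its input first and then applying \<open>f\<close> is the same
  as reading the input off its output: \<open>sel [Y] [X][Y] \<cdot> f = ([X] \<otimes> f) \<cdot> copy\<close>. For a kernel \<open>f\<close> and a set
  \<open>S\<close> with \<open>S \<inter> Y \<subseteq> X\<close>, let \<open>f\<langle>S\<rangle>: X \<union> S \<rightarrow> Y \<union> S\<close> be \<open>f\<close> extended by the identity on the variables in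
  \<open>S - X\<close>. Whiskering \<open>f \<mapsto> f\<langle>S\<rangle>\<close> is functorial and \<open>f\<langle>S\<rangle>\<langle>T\<rangle> = f\<langle>S \<union> T\<rangle>\<close>. The parallel composite of
  \<open>f: X \<rightarrow> Y\<close> and \<open>g: U \<rightarrow> V\<close> is \<open>f\<langle>U\<rangle>\<close> followed by \<open>g\<langle>Y\<rangle>\<close>, and equally \<open>g\<langle>X\<rangle>\<close> followed by \<open>f\<langle>V\<rangle>\<close>; and
  \<open>f \<sqsubseteq> g\<close> iff \<open>g\<close> is some \<open>f\<langle>Z\<rangle>\<close> followed by a kernel. All frame axioms follow from these facts.
\<close>

section \<open>Markov categories whose objects are lists\<close>

text \<open>The equations for \<open>Dom\<close> and \<open>Cod\<close> hold for all arguments,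
  composable or not, because the elements of \<open>var_category\<close> carry their endpoint lists.
  Types can then be computed by rewriting without side conditions.\<close>

locale list_markov_category = markov_category D
  for D :: "('v list, 'm) markov_data" (structure) +
  assumes Obj_eq [simp]: "Obj D = UNIV"
    and TensObj_eq [simp]: "TensObj D K L = K @ L"
    and Unit_eq [simp]: "Unit D = []"
    and Dom_Comp [simp]: "Dom D (g \<cdot> f) = Dom D f"
    and Cod_Comp [simp]: "Cod D (g \<cdot> f) = Cod D g"
    and Dom_Tens [simp]: "Dom D (f \<otimes> g) = Dom D f @ Dom D g"
    and Cod_Tens [simp]: "Cod D (f \<otimes> g) = Cod D f @ Cod D g"
begin

section \<open>Typing rules and Markov laws oriented for rewriting\<close>

lemma Hom_iff: "f \<in> Hom D K L \<longleftrightarrow> f \<in> Arr D \<and> Dom D f = K \<and> Cod D f = L"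
  by (auto simp: Hom_def)

lemma Dom_Cod_structural [simp]:
  "Id D K \<in> Arr D" "Dom D (Id D K) = K" "Cod D (Id D K) = K"
  "Copy D K \<in> Arr D" "Dom D (Copy D K) = K" "Cod D (Copy D K) = K @ K"
  "Del D K \<in> Arr D" "Dom D (Del D K) = K" "Cod D (Del D K) = []"
  "Sym D K L \<in> Arr D" "Dom D (Sym D K L) = K @ L" "Cod D (Sym D K L) = L @ K"
  using Id_Hom[of K] Copy_Hom[of K] Del_Hom[of K] Sym_Hom[of K L] by (simp_all add: Hom_iff)

lemma Arr_Comp [simp]: "f \<in> Arr D \<Longrightarrow> g \<in> Arr D \<Longrightarrow> Cod D f = Dom D g \<Longrightarrow> g \<cdot> f \<in> Arr D"
  using Comp_Hom[of f _ _ g] by (simp add: Hom_iff)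

lemma Arr_Tens [simp]: "f \<in> Arr D \<Longrightarrow> g \<in> Arr D \<Longrightarrow> f \<otimes> g \<in> Arr D"
  using Tens_Hom[of f _ _ g] by (simp add: Hom_iff)

lemma Comp_assoc' [simp]:
  "f \<in> Arr D \<Longrightarrow> g \<in> Arr D \<Longrightarrow> h \<in> Arr D \<Longrightarrow> Cod D f = Dom D g \<Longrightarrow> Cod D g = Dom D h \<Longrightarrow>
    (h \<cdot> g) \<cdot> f = h \<cdot> g \<cdot> f"
  using Comp_assoc[of f _ _ g _ h] by (simp add: Hom_iff)

lemma Comp_Id' [simp]: "f \<in> Arr D \<Longrightarrow> Dom D f = K \<Longrightarrow> f \<cdot> Id D K = f"
  and Id_Comp' [simp]: "f \<in> Arr D \<Longrightarrow> Cod D f = K \<Longrightarrow> Id D K \<cdot> f = f"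
  using Comp_Id[of f] Id_Comp[of f] by (simp_all add: Hom_iff)

declare Tens_assoc [simp]

lemma Tens_Id' [simp]: "Id D K \<otimes> Id D L = Id D (K @ L)"
  using Tens_Id[of K L] by simp

lemma Tens_Unit' [simp]: "f \<in> Arr D \<Longrightarrow> f \<otimes> Id D [] = f" "f \<in> Arr D \<Longrightarrow> Id D [] \<otimes> f = f"
  using Tens_Unit[of f] Unit_Tens[of f] by simp_all

lemma interchange:
  "f \<in> Arr D \<Longrightarrow> g \<in> Arr D \<Longrightarrow> f' \<in> Arr D \<Longrightarrow> g' \<in> Arr D \<Longrightarrow> Cod D f = Dom D g \<Longrightarrow>
    Cod D f' = Dom D g' \<Longrightarrow> (g \<otimes> g') \<cdot> (f \<otimes> f') = (g \<cdot> f) \<otimes> (g' \<cdot> f')"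
  using Tens_Comp[of f _ _ g _ f' _ _ g'] by (simp add: Hom_iff)

lemma interchange_left:
  "f \<in> Arr D \<Longrightarrow> g \<in> Arr D \<Longrightarrow> f' \<in> Arr D \<Longrightarrow> g' \<in> Arr D \<Longrightarrow> h \<in> Arr D \<Longrightarrow> Cod D f = Dom D g \<Longrightarrow>
    Cod D f' = Dom D g' \<Longrightarrow> Cod D h = Dom D f @ Dom D f' \<Longrightarrow>
    (g \<otimes> g') \<cdot> (f \<otimes> f') \<cdot> h = ((g \<cdot> f) \<otimes> (g' \<cdot> f')) \<cdot> h"
  by (simp flip: Comp_assoc' add: interchange)

lemma Sym_natural':
  "f \<in> Arr D \<Longrightarrow> g \<in> Arr D \<Longrightarrow> Cod D f = K \<Longrightarrow> Cod D g = L \<Longrightarrow>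
    Sym D K L \<cdot> (f \<otimes> g) = (g \<otimes> f) \<cdot> Sym D (Dom D f) (Dom D g)"
  using Sym_natural[of f _ _ g] by (simp add: Hom_iff)

lemma Del_natural' [simp]: "f \<in> Arr D \<Longrightarrow> Cod D f = K \<Longrightarrow> Del D K \<cdot> f = Del D (Dom D f)"
  using Del_natural[of f] by (simp add: Hom_iff)

lemma coassoc: "(Copy D K \<otimes> Id D K) \<cdot> Copy D K = (Id D K \<otimes> Copy D K) \<cdot> Copy D K"
  using Copy_coassoc[of K] by simp

lemma counit [simp]:
  "(Del D K \<otimes> Id D K) \<cdot> Copy D K = Id D K" "(Id D K \<otimes> Del D K) \<cdot> Copy D K = Id D K"
  using Copy_counit_left[of K] Copy_counit_right[of K] by simp_all

lemma counit_Tens: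
  assumes "f \<in> Arr D" "Dom D f = K"
  shows "(Del D K \<otimes> f) \<cdot> Copy D K = f" "(f \<otimes> Del D K) \<cdot> Copy D K = f"
proof -
  have "Del D K \<otimes> f = (Id D [] \<otimes> f) \<cdot> (Del D K \<otimes> Id D K)"
    using assms by (subst interchange) simp_all
  then show "(Del D K \<otimes> f) \<cdot> Copy D K = f" using assms by simp
  have "f \<otimes> Del D K = (f \<otimes> Id D []) \<cdot> (Id D K \<otimes> Del D K)"
    using assms by (subst interchange) simp_all
  then show "(f \<otimes> Del D K) \<cdot> Copy D K = f" using assms by simp
qed

text \<open>At the unit object the counit law reads
  \<open>Del D [] \<cdot> Copy D [] = Id D []\<close>, and naturality of deletion along
  \<open>Copy D []\<close> identifies the left side with \<open>Del D []\<close>.\<close>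

lemma Del_Nil [simp]: "Del D [] = Id D []"
  using counit_Tens(1)[of "Id D []" "[]"] by simp

lemma Copy_Nil [simp]: "Copy D [] = Id D []"
  using counit(1)[of "[]"] by (simp del: counit)

lemma Del_append: "Del D (K @ L) = Del D K \<otimes> Del D L"
  using Del_TensObj[of K L] by simp

lemma Copy_append:
  "Copy D (K @ L) = (Id D K \<otimes> Sym D K L \<otimes> Id D L) \<cdot> (Copy D K \<otimes> Copy D L)"
  using Copy_TensObj[of K L] by simp

lemma Sym_Copy [simp]: "Sym D K K \<cdot> Copy D K = Copy D K"
  using Copy_commute[of K] by simp

section \<open>Deterministic morphisms and selection maps\<close>

text \<open>Together with naturality of deletion this says that \<open>f\<close> is a homomorphism
  of comonoids.\<close>

definition deterministic :: "'m \<Rightarrow> bool" where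
  "deterministic f \<longleftrightarrow> f \<in> Arr D \<and> Copy D (Cod D f) \<cdot> f = (f \<otimes> f) \<cdot> Copy D (Dom D f)"

lemma deterministic_Id: "deterministic (Id D K)"
  by (simp add: deterministic_def)

lemma deterministic_Del: "deterministic (Del D K)"
  by (simp add: deterministic_def counit_Tens)

lemma deterministic_Comp:
  assumes "deterministic f" "deterministic g" "Cod D f = Dom D g"
  shows "deterministic (g \<cdot> f)"
proof -
  have *: "f \<in> Arr D" "g \<in> Arr D" using assms by (simp_all add: deterministic_def)
  have "Copy D (Cod D g) \<cdot> g \<cdot> f = (Copy D (Cod D g) \<cdot> g) \<cdot> f" using assms * by simp
  also have "\<dots> = (g \<otimes> g) \<cdot> Copy D (Dom D g) \<cdot> f"
    using assms * by (simp add: deterministic_def)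
  also have "\<dots> = (g \<otimes> g) \<cdot> (f \<otimes> f) \<cdot> Copy D (Dom D f)"
    using assms * by (simp add: deterministic_def)
  finally show ?thesis using assms * by (simp add: deterministic_def interchange_left)
qed

lemma deterministic_Tens:
  assumes "deterministic f" "deterministic g"
  shows "deterministic (f \<otimes> g)"
proof -
  have *: "f \<in> Arr D" "g \<in> Arr D" using assms by (simp_all add: deterministic_def)
  let ?A = "Dom D f" and ?B = "Cod D f" and ?A' = "Dom D g" and ?B' = "Cod D g"
  have "Copy D (?B @ ?B') \<cdot> (f \<otimes> g) =
      (Id D ?B \<otimes> Sym D ?B ?B' \<otimes> Id D ?B') \<cdot> (Copy D ?B \<otimes> Copy D ?B') \<cdot> (f \<otimes> g)"
    using * by (simp add: Copy_append)
  also have "(Copy D ?B \<otimes> Copy D ?B') \<cdot> (f \<otimes> g) =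
      ((f \<otimes> f) \<otimes> (g \<otimes> g)) \<cdot> (Copy D ?A \<otimes> Copy D ?A')"
    using assms * by (simp add: deterministic_def interchange del: Tens_assoc)
  also have "(Id D ?B \<otimes> Sym D ?B ?B' \<otimes> Id D ?B') \<cdot> \<dots> =
      ((Id D ?B \<otimes> Sym D ?B ?B' \<otimes> Id D ?B') \<cdot> (f \<otimes> (f \<otimes> g) \<otimes> g)) \<cdot> (Copy D ?A \<otimes> Copy D ?A')"
    using * by simp
  also have "(Id D ?B \<otimes> Sym D ?B ?B' \<otimes> Id D ?B') \<cdot> (f \<otimes> (f \<otimes> g) \<otimes> g) =
      (f \<otimes> (g \<otimes> f) \<otimes> g) \<cdot> (Id D ?A \<otimes> Sym D ?A ?A' \<otimes> Id D ?A')"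
    using * by (simp add: interchange Sym_natural' del: Tens_assoc)
  finally show ?thesis
    using * by (simp add: deterministic_def Copy_append)
qed

text \<open>Both sides are fourfold copies, differing by a symmetry on the two middle outputs.
  Coassociativity makes these the outputs of one copy, which absorbs the symmetry by
  cocommutativity.\<close>

lemma deterministic_Copy: "deterministic (Copy D K)"
proof -
  let ?c = "Copy D K" and ?i = "Id D K"
  have "(?c \<otimes> ?c) \<cdot> ?c = (?c \<otimes> Id D (K @ K)) \<cdot> (?i \<otimes> ?c) \<cdot> ?c"
    by (simp add: interchange_left)
  also have "\<dots> = ((?c \<otimes> ?i) \<otimes> ?i) \<cdot> (?c \<otimes> ?i) \<cdot> ?c"
    by (simp add: coassoc)
  also have "\<dots> = (((?i \<otimes> ?c) \<cdot> ?c) \<otimes> ?i) \<cdot> ?c"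
    by (subst interchange_left) (simp_all add: coassoc)
  finally have 1: "(?c \<otimes> ?c) \<cdot> ?c = (((?i \<otimes> ?c) \<cdot> ?c) \<otimes> ?i) \<cdot> ?c" .
  have "Copy D (K @ K) \<cdot> ?c = ((?i \<otimes> Sym D K K) \<otimes> ?i) \<cdot> (?c \<otimes> ?c) \<cdot> ?c"
    by (simp add: Copy_append)
  also have "\<dots> = ((?i \<otimes> Sym D K K) \<otimes> ?i) \<cdot> (((?i \<otimes> ?c) \<cdot> ?c) \<otimes> ?i) \<cdot> ?c"
    by (simp only: 1)
  also have "\<dots> = (((?i \<otimes> ?c) \<cdot> ?c) \<otimes> ?i) \<cdot> ?c"
    by (subst interchange_left) (simp_all add: interchange_left)
  finally show ?thesis
    by (simp only: deterministic_def 1[symmetric]) simp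
qed

text \<open>The first equation of \<open>proj\<close> is a junk value. With repetitions, the first occurrence is projected.\<close>

primrec proj :: "'v list \<Rightarrow> 'v \<Rightarrow> 'm" where
  "proj [] y = Id D []"
| "proj (x # K) y = (if x = y then Id D [x] \<otimes> Del D K else Del D [x] \<otimes> proj K y)"

primrec sel :: "'v list \<Rightarrow> 'v list \<Rightarrow> 'm" where
  "sel K [] = Del D K"
| "sel K (y # L) = (proj K y \<otimes> sel K L) \<cdot> Copy D K"

lemma Dom_proj [simp]: "Dom D (proj K y) = K"
  and deterministic_proj: "deterministic (proj K y)"
  and Arr_proj [simp]: "proj K y \<in> Arr D"
  by (induction K) (auto simp: deterministic_Id deterministic_Del deterministic_Tens)

lemma Cod_proj [simp]: "y \<in> set K \<Longrightarrow> Cod D (proj K y) = [y]"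
  by (induction K) auto

lemma deterministic_sel: "deterministic (sel K L)"
  and Arr_sel [simp]: "sel K L \<in> Arr D"
  and Dom_sel [simp]: "Dom D (sel K L) = K"
  by (induction L) (auto simp: deterministic_Del deterministic_Tens deterministic_proj
    deterministic_Copy intro!: deterministic_Comp)

lemma Cod_sel [simp]: "set L \<subseteq> set K \<Longrightarrow> Cod D (sel K L) = L"
  by (induction L) auto

lemma sel_append: "sel K (L @ L') = (sel K L \<otimes> sel K L') \<cdot> Copy D K"
proof (induction L)
  case Nil
  then show ?case by (simp add: counit_Tens)
next
  case (Cons y L)
  have "sel K ((y # L) @ L') = (proj K y \<otimes> ((sel K L \<otimes> sel K L') \<cdot> Copy D K)) \<cdot> Copy D K"
    by (simp add: Cons)
  also have "\<dots> = (proj K y \<otimes> (sel K L \<otimes> sel K L')) \<cdot> (Id D K \<otimes> Copy D K) \<cdot> Copy D K"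
    by (subst interchange_left) simp_all
  also have "\<dots> = ((proj K y \<otimes> sel K L) \<otimes> sel K L') \<cdot> (Copy D K \<otimes> Id D K) \<cdot> Copy D K"
    by (simp add: coassoc)
  also have "\<dots> = (sel K (y # L) \<otimes> sel K L') \<cdot> Copy D K"
    by (subst interchange_left) simp_all
  finally show ?case .
qed

lemma proj_sel:
  "y \<in> set L \<Longrightarrow> set L \<subseteq> set K \<Longrightarrow> proj L y \<cdot> sel K L = proj K y"
proof (induction L)
  case (Cons z L)
  then show ?case
    by (cases "z = y") (simp_all add: interchange_left counit_Tens)
qed simp

text \<open>Determinism permits moving a shared \<open>d\<close> into both components of a pairing:
  one run of \<open>d\<close> followed by copying equals two runs on copied input.\<close>

lemma deterministic_Comp_pairing:
  assumes "deterministic d" "f \<in> Arr D" "g \<in> Arr D" "Dom D f = Cod D d" "Dom D g = Cod D d"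
    and "K = Cod D d"
  shows "(f \<otimes> g) \<cdot> Copy D K \<cdot> d = ((f \<cdot> d) \<otimes> (g \<cdot> d)) \<cdot> Copy D (Dom D d)"
  using assms by (simp add: deterministic_def interchange_left)

text \<open>By induction on \<open>M\<close>, each projection is moved through the deterministic
  \<open>sel K L\<close>. This composition law takes the place of coherence computations.\<close>

lemma sel_sel:
  "set M \<subseteq> set L \<Longrightarrow> set L \<subseteq> set K \<Longrightarrow> sel L M \<cdot> sel K L = sel K M"
  by (induction M) (simp_all add: deterministic_Comp_pairing deterministic_sel proj_sel)

lemma sel_sel_left:
  "set M \<subseteq> set L \<Longrightarrow> set L \<subseteq> set K \<Longrightarrow> h \<in> Arr D \<Longrightarrow> Cod D h = K \<Longrightarrow>
    sel L M \<cdot> sel K L \<cdot> h = sel K M \<cdot> h"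
  by (simp add: sel_sel flip: Comp_assoc')

text \<open>\<open>A\<close> and \<open>A'\<close> may share variables. Each tensor factor reads its
  own block, whereas \<open>sel (A @ A')\<close> would read a shared variable from its first
  occurrence.\<close>

lemma sel_Tens_sel:
  "set B \<subseteq> set A \<Longrightarrow> set B' \<subseteq> set A' \<Longrightarrow> set A \<subseteq> set K \<Longrightarrow> set A' \<subseteq> set K \<Longrightarrow>
    (sel A B \<otimes> sel A' B') \<cdot> sel K (A @ A') = sel K (B @ B')"
  by (simp add: sel_append interchange_left sel_sel)

lemma sel_Cons_notin:
  assumes "set M \<subseteq> set K" "x \<notin> set M"
  shows "sel (x # K) M = Del D [x] \<otimes> sel K M"
  using assms
proof (induction M)
  case Nil
  then show ?case using Del_append[of "[x]" K] by simp
next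
  case (Cons y M)
  \<comment> \<open>The morphism \<open>d\<close> discards \<open>x\<close> and keeps
    \<open>K\<close>; being deterministic, it can be factored out of the pairing.\<close>
  define d where "d = Del D [x] \<otimes> Id D K"
  have d: "deterministic d" "d \<in> Arr D" "Dom D d = x # K" "Cod D d = K"
    by (simp_all add: d_def deterministic_Tens deterministic_Del deterministic_Id)
  have d_Comp: "h \<cdot> d = Del D [x] \<otimes> h" if "h \<in> Arr D" "Dom D h = K" for h
    using interchange[of "Del D [x]" "Id D []" "Id D K" h] that by (simp add: d_def)
  have "sel (x # K) (y # M) = ((proj K y \<cdot> d) \<otimes> (sel K M \<cdot> d)) \<cdot> Copy D (Dom D d)"
    using Cons by (simp add: d_Comp d)
  also have "\<dots> = sel K (y # M) \<cdot> d"
    using d by (subst deterministic_Comp_pairing[symmetric]) simp_all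
  finally show ?case using Cons.prems by (simp add: d_Comp)
qed

lemma sel_self [simp]: "distinct K \<Longrightarrow> sel K K = Id D K"
proof (induction K)
  case (Cons x K)
  have "sel (x # K) (x # K) = ((Id D [x] \<otimes> Del D K) \<otimes> (Del D [x] \<otimes> Id D K)) \<cdot> Copy D ([x] @ K)"
    using Cons by (simp add: sel_Cons_notin)
  \<comment> \<open>\<open>Copy D ([x] @ K)\<close> copies both blocks and swaps the two middle
    outputs. These are exactly the discarded ones, so deletion absorbs the symmetry and the counit
    law applies to each block.\<close>
  also have "\<dots> = (Id D [x] \<otimes> (Del D (K @ [x]) \<otimes> Id D K)) \<cdot> (Id D [x] \<otimes> Sym D [x] K \<otimes> Id D K)
      \<cdot> (Copy D [x] \<otimes> Copy D K)"
    by (simp only: Copy_append) (simp add: Del_append)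
  also have "\<dots> = (Id D [x] \<otimes> (Del D ([x] @ K) \<otimes> Id D K)) \<cdot> (Copy D [x] \<otimes> Copy D K)"
    by (simp add: interchange_left interchange)
  also have "\<dots> = ((Id D [x] \<otimes> Del D [x]) \<otimes> (Del D K \<otimes> Id D K)) \<cdot> (Copy D [x] \<otimes> Copy D K)"
    by (simp only: Del_append) simp
  also have "\<dots> = Id D (x # K)"
    by (subst interchange) simp_all
  finally show ?case .
qed simp

lemma Copy_eq_sel: "distinct K \<Longrightarrow> Copy D K = sel K (K @ K)"
  by (simp add: sel_append)

lemma sel_Tens:
  assumes "distinct (A @ A')" "set B \<subseteq> set A" "set B' \<subseteq> set A'"
  shows "sel A B \<otimes> sel A' B' = sel (A @ A') (B @ B')"
  using sel_Tens_sel[of B A B' A' "A @ A'"] assms by simp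

text \<open>By cocommutativity the two halves of a pairing may be exchanged.\<close>

lemma Sym_sel:
  assumes "set L \<subseteq> set K" "set L' \<subseteq> set K"
  shows "Sym D L L' \<cdot> sel K (L @ L') = sel K (L' @ L)"
proof -
  have "Sym D L L' \<cdot> sel K (L @ L') = (Sym D L L' \<cdot> (sel K L \<otimes> sel K L')) \<cdot> Copy D K"
    using assms by (simp add: sel_append)
  also have "\<dots> = (sel K L' \<otimes> sel K L) \<cdot> Sym D K K \<cdot> Copy D K"
    using assms by (simp add: Sym_natural' del: Sym_Copy)
  finally show ?thesis by (simp add: sel_append)
qed

section \<open>Rewirings as selection maps\<close>

lemma Sym_eq_sel: "distinct (K @ L) \<Longrightarrow> Sym D K L = sel (K @ L) (L @ K)"
  using Sym_sel[of K "K @ L" L] by simp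

text \<open>Coherence in the form used here, by induction over the generators: composites follow
  from \<open>sel_sel\<close>, tensors from \<open>sel_Tens\<close>. The multiset equation passes
  distinctness on to intermediate lists.\<close>

lemma rewirings_eq_sel:
  assumes "s \<in> rewirings D"
  shows "s \<in> Arr D \<and> mset (Dom D s) = mset (Cod D s) \<and>
    (distinct (Dom D s) \<longrightarrow> s = sel (Dom D s) (Cod D s))"
  using assms
proof induction
  case (Comp s t)
  then have "set (Dom D t) = set (Dom D s)" "set (Dom D t) = set (Cod D t)"
      "distinct (Dom D s) \<longleftrightarrow> distinct (Dom D t)"
    using mset_eq_setD mset_eq_imp_distinct_iff by metis+
  moreover from this Comp have "distinct (Dom D s) \<Longrightarrow> t \<cdot> s = sel (Dom D s) (Cod D t)"
    using sel_sel[of "Cod D t" "Dom D t" "Dom D s"] by simp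
  ultimately show ?case using Comp by simp
next
  case (Tens s t)
  then have "set (Dom D s) = set (Cod D s)" "set (Dom D t) = set (Cod D t)"
    by (metis mset_eq_setD)+
  moreover from this Tens have "distinct (Dom D s @ Dom D t) \<Longrightarrow>
      s \<otimes> t = sel (Dom D s @ Dom D t) (Cod D s @ Cod D t)"
    using sel_Tens[of "Dom D s" "Dom D t" "Cod D s" "Cod D t"] by simp
  ultimately show ?case using Tens by simp
qed (simp_all add: Sym_eq_sel)

text \<open>The target is built from the front: a block symmetry brings its first variable to the
  head, and the induction hypothesis rearranges the rest.\<close>

lemma rewiring_exists: "mset K = mset L \<Longrightarrow> \<exists>s. is_rewiring D K L s"
proof (induction L arbitrary: K)
  case Nil
  then show ?case
    by (auto simp: is_rewiring_def intro!: exI[of _ "Id D []"] rewirings.Id)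
next
  case (Cons y L)
  then have "y \<in> set K" by (metis list.set_intros(1) mset_eq_setD)
  then obtain K1 K2 where K: "K = K1 @ y # K2" by (meson split_list)
  with Cons obtain s where "is_rewiring D (K1 @ K2) L s" by fastforce
  then have "is_rewiring D K (y # L) ((Id D [y] \<otimes> s) \<cdot> (Sym D K1 [y] \<otimes> Id D K2))"
    by (auto simp: is_rewiring_def K intro!: rewirings.intros)
  then show ?case by blast
qed

text \<open>Distinctness gives uniqueness through \<open>rewirings_eq_sel\<close>, and equality of
  multisets gives existence, so the description in \<open>rewire\<close> denotes a
  selection.\<close>

lemma is_rewiring_iff:
  assumes "distinct K" "distinct L" "set K = set L"
  shows "is_rewiring D K L s \<longleftrightarrow> s = sel K L"
proof -
  have "is_rewiring D K L t \<Longrightarrow> t = sel K L" for t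
    using rewirings_eq_sel[of t] assms by (auto simp: is_rewiring_def)
  moreover have "mset K = mset L" using assms by (simp add: set_eq_iff_mset_eq_distinct)
  ultimately show ?thesis using rewiring_exists[of K L] by blast
qed

lemma rewire_eq_sel: "distinct K \<Longrightarrow> distinct L \<Longrightarrow> set K = set L \<Longrightarrow> rewire D K L = sel K L"
  by (simp add: rewire_def is_rewiring_iff)

lemma sel_Tens_sel3:
  assumes "set B \<subseteq> set A" "set B' \<subseteq> set A'" "set B'' \<subseteq> set A''"
    and "set A \<subseteq> set K" "set A' \<subseteq> set K" "set A'' \<subseteq> set K"
  shows "(sel A B \<otimes> sel A' B' \<otimes> sel A'' B'') \<cdot> sel K (A @ A' @ A'') = sel K (B @ B' @ B'')"
  using assms by (simp add: sel_append[of K A] sel_append[of K B] interchange_left sel_Tens_sel sel_sel)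

lemma sel_swap:
  assumes "distinct P" "set P \<subseteq> set K" "set L \<subseteq> set K" "set L' \<subseteq> set K"
  shows "(Id D P \<otimes> Sym D L L') \<cdot> sel K (P @ L @ L') = sel K (P @ L' @ L)"
  using assms by (simp add: sel_append[of K P] interchange_left Sym_sel)

lemma sel_duplicate:
  assumes "distinct (L @ R)" "distinct K" "set K \<subseteq> set L"
  shows "(Id D K \<otimes> Sym D L R) \<cdot> (sel L (K @ L) \<otimes> Id D R) = sel (L @ R) (K @ R @ L)"
  using assms sel_Tens[of L R "K @ L" R] by (auto intro!: sel_swap)

end

section \<open>Kernels\<close>

locale kernel_category = list_markov_category D
  for D :: "('v::linorder list, 'm) markov_data" (structure)
begin

lemma finite_src [simp]: "finite (src D f)" and finite_tgt [simp]: "finite (tgt D f)"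
  by (simp_all add: src_def tgt_def)

lemma src_Comp [simp]: "src D (g \<cdot> f) = src D f" and tgt_Comp [simp]: "tgt D (g \<cdot> f) = tgt D g"
  by (simp_all add: src_def tgt_def)

lemma src_Id [simp]: "src D (Id D K) = set K" and tgt_Id [simp]: "tgt D (Id D K) = set K"
  by (simp_all add: src_def tgt_def)

section \<open>The input-preservation equation\<close>

lemma kernel_of_eq:
  assumes "finite Y" "X \<subseteq> Y"
  shows "kernel_of D X Y f' =
    sel (lst X @ lst (Y - X)) (lst Y) \<cdot> (Id D (lst X) \<otimes> f') \<cdot> Copy D (lst X)"
  using assms finite_subset[OF assms(2,1)] by (simp add: kernel_of_def rewire_eq_sel Un_absorb1)

text \<open>The input block inside the output is itself a copy of the input, so duplicating it
  afterwards is, by coassociativity, the same as copying the input beforehand.\<close>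

lemma kernel_of_input:
  assumes "finite Y" "X \<subseteq> Y" and f': "f' \<in> Hom D (lst X) (lst (Y - X))"
  shows "sel (lst Y) (lst X @ lst Y) \<cdot> kernel_of D X Y f' =
    (Id D (lst X) \<otimes> kernel_of D X Y f') \<cdot> Copy D (lst X)"
proof -
  have fin: "finite X" using assms finite_subset by blast
  define K W where "K = lst X" and "W = lst (Y - X)"
  have KW: "distinct K" "distinct W" "set K = X" "set W = Y - X"
    using assms fin by (simp_all add: K_def W_def)
  have f: "f' \<in> Arr D" "Dom D f' = K" "Cod D f' = W" using f' by (simp_all add: Hom_iff K_def W_def)
  let ?s = "sel (K @ W) (lst Y)"
  have "sel (K @ W) (K @ lst Y) = (Id D K \<otimes> ?s) \<cdot> sel (K @ W) (K @ K @ W)"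
    using sel_Tens_sel[of K K "lst Y" "K @ W" "K @ W"] assms KW by auto
  also have "sel (K @ W) (K @ K @ W) = Copy D K \<otimes> Id D W"
    using KW sel_Tens[of K W "K @ K" W] by (auto simp: Copy_eq_sel)
  finally have *: "sel (K @ W) (K @ lst Y) = (Id D K \<otimes> ?s) \<cdot> (Copy D K \<otimes> Id D W)" .
  have "sel (lst Y) (K @ lst Y) \<cdot> ?s \<cdot> (Id D K \<otimes> f') \<cdot> Copy D K =
      sel (K @ W) (K @ lst Y) \<cdot> (Id D K \<otimes> f') \<cdot> Copy D K"
    using assms KW f by (subst sel_sel_left) auto
  also have "\<dots> = (Id D K \<otimes> ?s) \<cdot> (Copy D K \<otimes> Id D W) \<cdot> (Id D K \<otimes> f') \<cdot> Copy D K"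
    unfolding * using assms KW f by auto
  also have "\<dots> = (Id D K \<otimes> ?s) \<cdot> (Id D (K @ K) \<otimes> f') \<cdot> (Copy D K \<otimes> Id D K) \<cdot> Copy D K"
    using f by (simp add: interchange_left)
  also have "\<dots> = (Id D K \<otimes> ?s) \<cdot> (Id D K \<otimes> (Id D K \<otimes> f')) \<cdot> (Id D K \<otimes> Copy D K) \<cdot> Copy D K"
    using f by (simp add: coassoc flip: Tens_Id')
  also have "\<dots> = (Id D K \<otimes> (?s \<cdot> (Id D K \<otimes> f') \<cdot> Copy D K)) \<cdot> Copy D K"
    using assms KW f by (simp add: interchange_left del: Tens_assoc)
  finally show ?thesis
    using assms by (simp add: kernel_of_eq K_def W_def)
qed

text \<open>By \<open>input\<close>, the copy of \<open>X\<close> beside \<open>f\<close> agrees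
  with the one inside its output, so the latter may be discarded and \<open>Y\<close> reassembled
  from the former.\<close>

lemma kernel_of_sel:
  assumes "finite Y" "X \<subseteq> Y" and f: "f \<in> Hom D (lst X) (lst Y)"
    and input: "sel (lst Y) (lst X @ lst Y) \<cdot> f = (Id D (lst X) \<otimes> f) \<cdot> Copy D (lst X)"
  shows "kernel_of D X Y (sel (lst Y) (lst (Y - X)) \<cdot> f) = f"
proof -
  have fin: "finite X" using assms finite_subset by blast
  let ?s = "sel (lst X @ lst (Y - X)) (lst Y)"
  have "kernel_of D X Y (sel (lst Y) (lst (Y - X)) \<cdot> f) =
      ?s \<cdot> (Id D (lst X) \<otimes> sel (lst Y) (lst (Y - X))) \<cdot> (Id D (lst X) \<otimes> f) \<cdot> Copy D (lst X)"
    using assms fin by (auto simp: kernel_of_eq interchange_left Hom_iff)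
  also have "\<dots> = ?s \<cdot> ((Id D (lst X) \<otimes> sel (lst Y) (lst (Y - X))) \<cdot> sel (lst Y) (lst X @ lst Y)) \<cdot> f"
    using assms fin by (auto simp: Hom_iff simp flip: input)
  also have "(Id D (lst X) \<otimes> sel (lst Y) (lst (Y - X))) \<cdot> sel (lst Y) (lst X @ lst Y) =
      sel (lst Y) (lst X @ lst (Y - X))"
    using assms fin sel_Tens_sel[of "lst X" "lst X" "lst (Y - X)" "lst Y" "lst Y"] by auto
  also have "?s \<cdot> \<dots> \<cdot> f = f"
    using assms fin by (subst sel_sel_left) (auto simp: Hom_iff)
  finally show ?thesis .
qed

text \<open>An equational criterion that mentions neither a nontrivial part nor a rewiring; the
  closure proofs work with it.\<close>

lemma is_kernel_iff:
  "is_kernel D X Y f \<longleftrightarrow> finite Y \<and> X \<subseteq> Y \<and> f \<in> Hom D (lst X) (lst Y) \<and>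
    sel (lst Y) (lst X @ lst Y) \<cdot> f = (Id D (lst X) \<otimes> f) \<cdot> Copy D (lst X)"
proof
  assume "is_kernel D X Y f"
  then obtain f' where fin: "finite X" "finite Y" and "X \<subseteq> Y"
    and f': "f' \<in> Hom D (lst X) (lst (Y - X))" and f: "f = kernel_of D X Y f'"
    by (auto simp: is_kernel_def)
  moreover have "f \<in> Hom D (lst X) (lst Y)"
    using fin f' \<open>X \<subseteq> Y\<close> unfolding f by (subst kernel_of_eq) (auto simp: Hom_iff)
  ultimately show "finite Y \<and> X \<subseteq> Y \<and> f \<in> Hom D (lst X) (lst Y) \<and>
    sel (lst Y) (lst X @ lst Y) \<cdot> f = (Id D (lst X) \<otimes> f) \<cdot> Copy D (lst X)"
    by (simp add: kernel_of_input)
next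
  assume *: "finite Y \<and> X \<subseteq> Y \<and> f \<in> Hom D (lst X) (lst Y) \<and>
    sel (lst Y) (lst X @ lst Y) \<cdot> f = (Id D (lst X) \<otimes> f) \<cdot> Copy D (lst X)"
  then have "sel (lst Y) (lst (Y - X)) \<cdot> f \<in> Hom D (lst X) (lst (Y - X))"
    by (auto simp: Hom_iff)
  moreover have "f = kernel_of D X Y (sel (lst Y) (lst (Y - X)) \<cdot> f)"
    using * by (simp add: kernel_of_sel)
  ultimately show "is_kernel D X Y f"
    using * finite_subset unfolding is_kernel_def by blast
qed

lemma Ker_iff:
  "f \<in> Ker D \<longleftrightarrow> f \<in> Arr D \<and> Dom D f = lst (src D f) \<and> Cod D f = lst (tgt D f) \<and>
    src D f \<subseteq> tgt D f \<and>
    sel (Cod D f) (Dom D f @ Cod D f) \<cdot> f = (Id D (Dom D f) \<otimes> f) \<cdot> Copy D (Dom D f)"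
proof -
  have "is_kernel D X Y f \<Longrightarrow> X = src D f \<and> Y = tgt D f" for X Y
    by (auto simp: is_kernel_iff Hom_iff src_def tgt_def dest: finite_subset)
  then have "f \<in> Ker D \<longleftrightarrow> is_kernel D (src D f) (tgt D f) f"
    by (auto simp: Ker_def)
  then show ?thesis unfolding is_kernel_iff Hom_iff by (metis finite_tgt)
qed

lemma Ker_Arr: "f \<in> Ker D \<Longrightarrow> f \<in> Arr D"
  and Ker_Dom: "f \<in> Ker D \<Longrightarrow> Dom D f = lst (src D f)"
  and Ker_Cod: "f \<in> Ker D \<Longrightarrow> Cod D f = lst (tgt D f)"
  and Ker_subset: "f \<in> Ker D \<Longrightarrow> src D f \<subseteq> tgt D f"
  by (simp_all add: Ker_iff)

lemma Ker_input:
  "f \<in> Ker D \<Longrightarrow> sel (lst (tgt D f)) (lst (src D f) @ lst (tgt D f)) \<cdot> f =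
    (Id D (lst (src D f)) \<otimes> f) \<cdot> Copy D (lst (src D f))"
  by (metis Ker_iff)

lemmas Ker_simps [simp] = Ker_Arr Ker_Dom Ker_Cod

text \<open>Discarding the kept input of \<open>kernel_of\<close> leaves \<open>f'\<close> by the
  counit law, which gives uniqueness; \<open>kernel_of_sel\<close> gives existence.\<close>

lemma nontrivial_part_eq:
  assumes "f \<in> Ker D"
  shows "nontrivial_part D f = sel (lst (tgt D f)) (lst (tgt D f - src D f)) \<cdot> f"
proof -
  define X Y where "X = src D f" and "Y = tgt D f"
  have XY: "finite X" "finite Y" "X \<subseteq> Y" using assms by (simp_all add: X_def Y_def Ker_subset)
  have f: "f \<in> Hom D (lst X) (lst Y)" using assms by (simp add: Hom_iff X_def Y_def)
  have "f' = sel (lst Y) (lst (Y - X)) \<cdot> f"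
    if f': "f' \<in> Hom D (lst X) (lst (Y - X))" and eq: "f = kernel_of D X Y f'" for f'
  proof -
    let ?K = "lst X" and ?W = "lst (Y - X)"
    have "sel (lst Y) ?W \<cdot> f = sel (?K @ ?W) ?W \<cdot> (Id D ?K \<otimes> f') \<cdot> Copy D ?K"
      using XY f' unfolding eq
      by (subst kernel_of_eq) (auto simp: Hom_iff intro!: sel_sel_left)
    also have "sel (?K @ ?W) ?W = Del D ?K \<otimes> Id D ?W"
      using XY sel_Tens[of ?K ?W "[]" ?W] by auto
    finally show ?thesis
      using f' by (simp add: Hom_iff interchange_left counit_Tens)
  qed
  moreover have "kernel_of D X Y (sel (lst Y) (lst (Y - X)) \<cdot> f) = f"
    using XY f assms by (intro kernel_of_sel) (simp_all add: X_def Y_def Ker_input)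
  moreover have "sel (lst Y) (lst (Y - X)) \<cdot> f \<in> Hom D (lst X) (lst (Y - X))"
    using XY f by (auto simp: Hom_iff)
  ultimately show ?thesis
    unfolding nontrivial_part_def X_def[symmetric] Y_def[symmetric]
    by (intro the_equality) auto
qed

lemma Id_Ker [simp]: "finite X \<Longrightarrow> Id D (lst X) \<in> Ker D"
  unfolding Ker_iff by (simp add: sel_append)

lemma Comp_Ker:
  assumes f: "f \<in> Ker D" and g: "g \<in> Ker D" and fg: "tgt D f = src D g"
  shows "g \<cdot> f \<in> Ker D"
proof -
  define K L M where "K = lst (src D f)" and "L = lst (src D g)" and "M = lst (tgt D g)"
  have KLM: "distinct K" "distinct L" "distinct M" "set K \<subseteq> set L" "set L \<subseteq> set M"
    using assms Ker_subset[of f] Ker_subset[of g] by (simp_all add: K_def L_def M_def)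
  have ty: "f \<in> Arr D" "g \<in> Arr D" "Dom D f = K" "Cod D f = L" "Dom D g = L" "Cod D g = M"
    using assms by (simp_all add: K_def L_def M_def)
  have f_input: "sel L (K @ L) \<cdot> f = (Id D K \<otimes> f) \<cdot> Copy D K"
    and g_input: "sel M (L @ M) \<cdot> g = (Id D L \<otimes> g) \<cdot> Copy D L"
    using Ker_input[OF f] Ker_input[OF g] assms by (simp_all add: K_def L_def M_def)
  \<comment> \<open>The input of the composite is read through the input \<open>L\<close> of
    \<open>g\<close>, so that the equations for \<open>g\<close> and \<open>f\<close> apply in
    turn.\<close>
  have "sel M (K @ M) = (sel L K \<otimes> Id D M) \<cdot> sel M (L @ M)"
    using KLM sel_Tens_sel[of K L M M M] by simp
  then have "sel M (K @ M) \<cdot> g \<cdot> f = (sel L K \<otimes> Id D M) \<cdot> (sel M (L @ M) \<cdot> g) \<cdot> f"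
    using KLM ty by simp
  also have "\<dots> = (Id D K \<otimes> g) \<cdot> ((sel L K \<otimes> Id D L) \<cdot> Copy D L) \<cdot> f"
    using KLM ty by (simp add: g_input interchange_left)
  also have "(sel L K \<otimes> Id D L) \<cdot> Copy D L = sel L (K @ L)"
    using KLM by (simp add: sel_append)
  also have "(Id D K \<otimes> g) \<cdot> \<dots> \<cdot> f = (Id D K \<otimes> (g \<cdot> f)) \<cdot> Copy D K"
    using KLM ty by (simp add: f_input interchange_left)
  finally show ?thesis
    unfolding Ker_iff using assms ty Ker_subset[of f] Ker_subset[of g] by (simp add: K_def M_def)
qed

section \<open>Whiskering\<close>

definition whisker :: "'m \<Rightarrow> 'v set \<Rightarrow> 'm" where
  "whisker f S =
    sel (lst (tgt D f) @ lst (S - src D f)) (lst (tgt D f \<union> S)) \<cdot> (f \<otimes> Id D (lst (S - src D f)))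
    \<cdot> sel (lst (src D f \<union> S)) (lst (src D f) @ lst (S - src D f))"

text \<open>\<open>S\<close> may overlap the target only in inputs, so the adjoined variables
  \<open>S - src D f\<close> are disjoint from the target and the lists in \<open>whisker\<close>
  have no repetitions.\<close>

definition fresh_for :: "'v set \<Rightarrow> 'm \<Rightarrow> bool" where
  "fresh_for S f \<longleftrightarrow> finite S \<and> S \<inter> tgt D f \<subseteq> src D f"

context
  fixes f and S :: "'v set"
  assumes f: "f \<in> Ker D" and S: "finite S"
begin

lemma Dom_whisker [simp]: "Dom D (whisker f S) = lst (src D f \<union> S)"
  using S by (simp add: whisker_def)

lemma Cod_whisker [simp]: "Cod D (whisker f S) = lst (tgt D f \<union> S)"
  using f S Ker_subset[OF f] by (auto simp: whisker_def intro!: Cod_sel)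

lemma Arr_whisker [simp]: "whisker f S \<in> Arr D"
  using f S Ker_subset[OF f] by (auto simp: whisker_def)

lemma src_whisker [simp]: "src D (whisker f S) = src D f \<union> S"
  using S by (simp add: src_def[of D "whisker f S"])

lemma tgt_whisker [simp]: "tgt D (whisker f S) = tgt D f \<union> S"
  using S by (simp add: tgt_def[of D "whisker f S"])

end

text \<open>Permutations of the adjoined block before and after \<open>f\<close> cancel.\<close>

lemma whisker_eq:
  assumes f: "f \<in> Ker D" and S: "fresh_for S f" and R: "distinct R" "set R = S - src D f"
  shows "whisker f S =
    sel (lst (tgt D f) @ R) (lst (tgt D f \<union> S)) \<cdot> (f \<otimes> Id D R)
    \<cdot> sel (lst (src D f \<union> S)) (lst (src D f) @ R)"
proof -
  define K L E Q T where "K = lst (src D f)" and "L = lst (tgt D f)" and "E = lst (S - src D f)"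
    and "Q = lst (src D f \<union> S)" and "T = lst (tgt D f \<union> S)"
  note defs = K_def L_def E_def Q_def T_def
  have fin: "finite S" using S by (simp add: fresh_for_def)
  have sets: "distinct (K @ R)" "distinct (L @ R)" "distinct (K @ E)" "distinct (L @ E)"
    "set E = set R" "set K \<union> set R = set Q" "set T = set L \<union> set R"
    using S R fin Ker_subset[OF f] by (auto simp: defs fresh_for_def)
  have ty: "f \<in> Arr D" "Dom D f = K" "Cod D f = L" using f by (simp_all add: defs)
  have "f \<otimes> Id D E = (Id D L \<otimes> sel R E) \<cdot> (f \<otimes> Id D R) \<cdot> (Id D K \<otimes> sel E R)"
    using sets ty by (simp add: interchange sel_sel)
  also have "Id D L \<otimes> sel R E = sel (L @ R) (L @ E)"
    using sets sel_Tens[of L R L E] by simp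
  also have "Id D K \<otimes> sel E R = sel (K @ E) (K @ R)"
    using sets sel_Tens[of K E K R] by simp
  finally have "sel (L @ E) T \<cdot> (f \<otimes> Id D E) \<cdot> sel Q (K @ E) =
      sel (L @ E) T \<cdot> sel (L @ R) (L @ E) \<cdot> (f \<otimes> Id D R) \<cdot> sel (K @ E) (K @ R) \<cdot> sel Q (K @ E)"
    using sets ty by simp
  also have "\<dots> = sel (L @ R) T \<cdot> (f \<otimes> Id D R) \<cdot> sel Q (K @ R)"
    using sets ty by (simp add: sel_sel sel_sel_left)
  finally show ?thesis by (simp add: whisker_def defs)
qed

text \<open>A duplicate of part of the input may be read off before or after applying the kernel.\<close>

lemma sel_whisker:
  assumes f: "f \<in> Ker D" and S: "fresh_for S f" and P: "set P \<subseteq> src D f \<union> S"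
  shows "sel (lst (tgt D f \<union> S)) (P @ lst (tgt D f)) \<cdot> whisker f S =
    (Id D P \<otimes> f) \<cdot> sel (lst (src D f \<union> S)) (P @ lst (src D f))"
proof -
  define K L R Q T where "K = lst (src D f)" and "L = lst (tgt D f)" and "R = lst (S - src D f)"
    and "Q = lst (src D f \<union> S)" and "T = lst (tgt D f \<union> S)"
  have fin: "finite S" using S by (simp add: fresh_for_def)
  have KLR: "distinct (K @ R)" "distinct (L @ R)" "set K \<subseteq> set L" "set P \<subseteq> set K \<union> set R"
    "set K \<union> set R = set Q" "set L \<union> set R = set T" "distinct Q"
    "set L \<subseteq> set T" "set Q \<subseteq> set T" "set K \<subseteq> set Q" "set R \<subseteq> set Q"
    using S P Ker_subset[OF f] fin by (auto simp: K_def L_def R_def Q_def T_def fresh_for_def)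
  have ty: "f \<in> Arr D" "Dom D f = K" "Cod D f = L" using f by (simp_all add: K_def L_def)
  let ?p = "sel (K @ R) P"
  \<comment> \<open>Since \<open>P\<close> consists of variables from \<open>K\<close> and
    \<open>R\<close>, it suffices to duplicate \<open>K @ R\<close> and read \<open>P\<close> from
    that copy.\<close>
  have "sel (L @ R) (P @ L) = (?p \<otimes> Id D L) \<cdot> sel (L @ R) (K @ R @ L)"
    using KLR sel_Tens_sel[of P "K @ R" L L "L @ R"] by simp
  also have "sel (L @ R) (K @ R @ L) = (Id D K \<otimes> Sym D L R) \<cdot> (sel L (K @ L) \<otimes> Id D R)"
    using KLR by (simp add: sel_duplicate)
  finally have 1: "sel (L @ R) (P @ L) =
      (?p \<otimes> Id D L) \<cdot> (Id D K \<otimes> Sym D L R) \<cdot> (sel L (K @ L) \<otimes> Id D R)" .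
  \<comment> \<open>By the input equation the copy of \<open>K\<close> can be made before
    \<open>f\<close>; naturality of the symmetry then moves \<open>f\<close> past
    \<open>R\<close>.\<close>
  have "(Id D K \<otimes> Sym D L R) \<cdot> (sel L (K @ L) \<otimes> Id D R) \<cdot> (f \<otimes> Id D R) =
      (Id D K \<otimes> Sym D L R) \<cdot> (((Id D K \<otimes> f) \<cdot> Copy D K) \<otimes> Id D R)"
    using Ker_input[OF f] KLR ty by (simp add: interchange K_def L_def)
  also have "\<dots> = (Id D K \<otimes> Sym D L R) \<cdot> ((Id D K \<otimes> f) \<otimes> Id D R) \<cdot> (Copy D K \<otimes> Id D R)"
    using ty by (subst interchange) simp_all
  also have "\<dots> = (Id D K \<otimes> (Sym D L R \<cdot> (f \<otimes> Id D R))) \<cdot> (Copy D K \<otimes> Id D R)"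
    using ty by (simp add: interchange_left)
  also have "\<dots> = (Id D K \<otimes> ((Id D R \<otimes> f) \<cdot> Sym D K R)) \<cdot> (Copy D K \<otimes> Id D R)"
    using ty by (simp add: Sym_natural')
  also have "\<dots> = (Id D K \<otimes> (Id D R \<otimes> f)) \<cdot> (Id D K \<otimes> Sym D K R) \<cdot> (Copy D K \<otimes> Id D R)"
    using ty by (subst interchange_left) simp_all
  also have "(Id D K \<otimes> Sym D K R) \<cdot> (Copy D K \<otimes> Id D R) = sel (K @ R) (K @ R @ K)"
    using KLR sel_duplicate[of K R K] by (simp add: Copy_eq_sel)
  also have "Id D K \<otimes> (Id D R \<otimes> f) = Id D (K @ R) \<otimes> f"
    using ty by (simp flip: Tens_Id')
  finally have 2: "(Id D K \<otimes> Sym D L R) \<cdot> (sel L (K @ L) \<otimes> Id D R) \<cdot> (f \<otimes> Id D R) =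
      (Id D (K @ R) \<otimes> f) \<cdot> sel (K @ R) (K @ R @ K)" .
  have "sel T (P @ L) \<cdot> whisker f S = sel (L @ R) (P @ L) \<cdot> (f \<otimes> Id D R) \<cdot> sel Q (K @ R)"
    unfolding whisker_def K_def[symmetric] L_def[symmetric] R_def[symmetric] Q_def[symmetric]
      T_def[symmetric]
    using KLR ty by (intro sel_sel_left) auto
  also have "\<dots> = (?p \<otimes> Id D L) \<cdot> ((Id D K \<otimes> Sym D L R) \<cdot> (sel L (K @ L) \<otimes> Id D R) \<cdot> (f \<otimes> Id D R))
      \<cdot> sel Q (K @ R)"
    unfolding 1 using KLR ty by simp
  also have "\<dots> = (?p \<otimes> Id D L) \<cdot> (Id D (K @ R) \<otimes> f) \<cdot> sel (K @ R) (K @ R @ K) \<cdot> sel Q (K @ R)"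
    unfolding 2 using KLR ty by simp
  also have "sel (K @ R) (K @ R @ K) \<cdot> sel Q (K @ R) = sel Q (K @ R @ K)"
    using KLR by (intro sel_sel) auto
  also have "(?p \<otimes> Id D L) \<cdot> (Id D (K @ R) \<otimes> f) \<cdot> \<dots> = (Id D P \<otimes> f) \<cdot> (?p \<otimes> Id D K) \<cdot> \<dots>"
    using KLR ty by (subst (1 2) interchange_left) auto
  also have "(?p \<otimes> Id D K) \<cdot> sel Q (K @ R @ K) = sel Q (P @ K)"
    using KLR sel_Tens_sel[of P "K @ R" K K Q] by auto
  finally show ?thesis by (simp only: K_def L_def Q_def T_def)
qed

text \<open>Every output variable occurs in \<open>Q\<close> or in the target of \<open>f\<close>,
  so the reading in \<open>sel_whisker\<close> with \<open>P = Q\<close> can be undone by a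
  selection.\<close>

lemma whisker_graph:
  assumes f: "f \<in> Ker D" and S: "fresh_for S f" and Q: "Q = lst (src D f \<union> S)"
  shows "whisker f S =
    sel (Q @ lst (tgt D f)) (lst (tgt D f \<union> S)) \<cdot> (Id D Q \<otimes> f) \<cdot> sel Q (Q @ lst (src D f))"
proof -
  let ?T = "lst (tgt D f \<union> S)"
  have fin: "finite S" using S by (simp add: fresh_for_def)
  have "whisker f S = sel (Q @ lst (tgt D f)) ?T \<cdot> sel ?T (Q @ lst (tgt D f)) \<cdot> whisker f S"
    using f fin Ker_subset[OF f] by (subst sel_sel_left) (auto simp: Q)
  then show ?thesis
    using f S fin by (simp add: sel_whisker Q)
qed

lemma whisker_Ker [simp]:
  assumes f: "f \<in> Ker D" and S: "fresh_for S f"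
  shows "whisker f S \<in> Ker D"
proof -
  define L Q T where "L = lst (tgt D f)" and "Q = lst (src D f \<union> S)" and "T = lst (tgt D f \<union> S)"
  have fin: "finite S" using S by (simp add: fresh_for_def)
  have sets: "distinct Q" "distinct T" "distinct L" "set L \<subseteq> set T" "set Q \<subseteq> set T"
    "set T \<subseteq> set Q \<union> set L" "set Q = src D f \<union> S"
    using fin Ker_subset[OF f] by (auto simp: L_def Q_def T_def)
  have ty: "f \<in> Arr D" "Cod D f = L" "whisker f S \<in> Arr D" "Dom D (whisker f S) = Q"
    "Cod D (whisker f S) = T"
    using f fin by (simp_all add: L_def Q_def T_def)
  \<comment> \<open>Two copies of \<open>Q\<close> are read off: one is the input demanded by the
    kernel equation, the other reassembles \<open>T\<close> by \<open>whisker_graph\<close>.\<close>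
  have "sel T (Q @ T) = (Id D Q \<otimes> sel (Q @ L) T) \<cdot> sel T (Q @ Q @ L)"
    using sets sel_Tens_sel[of Q Q T "Q @ L" T] by simp
  then have "sel T (Q @ T) \<cdot> whisker f S =
      (Id D Q \<otimes> sel (Q @ L) T) \<cdot> (sel T ((Q @ Q) @ L) \<cdot> whisker f S)"
    using sets ty by simp
  also have "\<dots> = (Id D Q \<otimes> sel (Q @ L) T) \<cdot> (Id D (Q @ Q) \<otimes> f) \<cdot> sel Q ((Q @ Q) @ lst (src D f))"
    using sel_whisker[OF f S, of "Q @ Q"] sets by (simp add: L_def Q_def T_def)
  also have "\<dots> = (Id D Q \<otimes> sel (Q @ L) T) \<cdot> (Id D Q \<otimes> (Id D Q \<otimes> f))
      \<cdot> (Id D Q \<otimes> sel Q (Q @ lst (src D f))) \<cdot> Copy D Q"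
    using ty sets sel_append[of Q Q "Q @ lst (src D f)"] by (simp flip: Tens_Id')
  also have "\<dots> = (Id D Q \<otimes> whisker f S) \<cdot> Copy D Q"
    using ty sets f whisker_graph[OF f S Q_def]
    by (simp add: interchange_left L_def T_def del: Tens_assoc)
  finally show ?thesis
    unfolding Ker_iff using f fin ty Ker_subset[OF f] by (auto simp: Q_def T_def)
qed

section \<open>Functoriality of whiskering\<close>

lemma whisker_absorb:
  assumes "f \<in> Ker D" "S \<subseteq> src D f"
  shows "whisker f S = f"
proof -
  have eqs: "S - src D f = {}" "src D f \<union> S = src D f" "tgt D f \<union> S = tgt D f"
    using assms Ker_subset[of f] by auto
  show ?thesis unfolding whisker_def eqs using assms by simp
qed

lemma whisker_Id:
  assumes "finite X" "finite S"
  shows "whisker (Id D (lst X)) S = Id D (lst (X \<union> S))"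
  using assms by (auto simp: whisker_def sel_sel)

lemma whisker_whisker:
  assumes f: "f \<in> Ker D" and ST: "fresh_for S f" "fresh_for T f"
  shows "whisker (whisker f S) T = whisker f (S \<union> T)"
proof -
  define K L A B Q U V W where defs: "K = lst (src D f)" "L = lst (tgt D f)" "A = lst (S - src D f)"
    "B = lst (T - (src D f \<union> S))" "Q = lst (src D f \<union> S)" "U = lst (tgt D f \<union> S)"
    "V = lst (src D f \<union> S \<union> T)" "W = lst (tgt D f \<union> S \<union> T)"
  have fin: "finite S" "finite T" using ST by (simp_all add: fresh_for_def)
  have sets: "distinct (K @ A @ B)" "distinct (L @ A @ B)" "distinct (Q @ B)" "distinct (U @ B)"
    "set Q = set K \<union> set A" "set U = set L \<union> set A" "set V = set K \<union> set A \<union> set B"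
    "set W = set L \<union> set A \<union> set B" and AB: "distinct (A @ B)" "set (A @ B) = S \<union> T - src D f"
    and fresh: "fresh_for (S \<union> T) f"
    using ST fin Ker_subset[OF f] by (auto simp: defs fresh_for_def)
  have ty: "f \<in> Arr D" "Dom D f = K" "Cod D f = L" using f by (simp_all add: defs)
  have w: "whisker f S = sel (L @ A) U \<cdot> (f \<otimes> Id D A) \<cdot> sel Q (K @ A)"
    by (simp only: whisker_def defs)
  have "sel (L @ A) U \<otimes> Id D B = sel (L @ A @ B) (U @ B)"
    using sets sel_Tens[of "L @ A" B U B] by simp
  moreover have "sel Q (K @ A) \<otimes> Id D B = sel (Q @ B) (K @ A @ B)"
    using sets sel_Tens[of Q B "K @ A" B] by simp
  moreover have "((sel (L @ A) U \<cdot> (f \<otimes> Id D A) \<cdot> sel Q (K @ A)) \<otimes> Id D B) =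
      (sel (L @ A) U \<otimes> Id D B) \<cdot> ((f \<otimes> Id D A) \<otimes> Id D B) \<cdot> (sel Q (K @ A) \<otimes> Id D B)"
    using sets ty by (simp add: interchange del: Tens_assoc)
  ultimately have "sel (U @ B) W \<cdot> ((sel (L @ A) U \<cdot> (f \<otimes> Id D A) \<cdot> sel Q (K @ A)) \<otimes> Id D B)
      \<cdot> sel V (Q @ B) =
      sel (U @ B) W \<cdot> sel (L @ A @ B) (U @ B) \<cdot> (f \<otimes> Id D (A @ B)) \<cdot> sel (Q @ B) (K @ A @ B)
      \<cdot> sel V (Q @ B)"
    using sets ty by (simp add: le_supI1 le_supI2)
  also have "\<dots> = sel (L @ A @ B) W \<cdot> (f \<otimes> Id D (A @ B)) \<cdot> sel V (K @ A @ B)"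
    using sets ty by (simp add: sel_sel sel_sel_left le_supI1 le_supI2)
  \<comment> \<open>\<open>A @ B\<close> lists all adjoined variables but need not be increasing, so
    \<open>whisker_eq\<close> is used in place of the definition.\<close>
  also have "\<dots> = whisker f (S \<union> T)"
    unfolding whisker_eq[OF f fresh AB] by (simp only: defs Un_assoc append_assoc)
  finally show ?thesis
    unfolding w[symmetric] using f fin by (simp add: whisker_def[of "whisker f S"] defs)
qed

lemma whisker_Comp:
  assumes f: "f \<in> Ker D" and g: "g \<in> Ker D" and fg: "tgt D f = src D g"
    and S: "finite S" "S \<inter> tgt D g \<subseteq> src D f"
  shows "whisker (g \<cdot> f) S = whisker g S \<cdot> whisker f S"
proof -
  \<comment> \<open>Every variable of \<open>S\<close> in the middle set lies in the target of
    \<open>g\<close>, hence in the input of \<open>f\<close>; both factors therefore adjoin the same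
    block.\<close>
  have R: "S - src D f = S - src D g"
    using S fg Ker_subset[OF f] Ker_subset[OF g] by auto
  define K L M R Q U V where defs: "K = lst (src D f)" "L = lst (src D g)" "M = lst (tgt D g)"
    "R = lst (S - src D g)" "Q = lst (src D f \<union> S)" "U = lst (src D g \<union> S)"
    "V = lst (tgt D g \<union> S)"
  have sets: "distinct (K @ R)" "distinct (L @ R)" "distinct (M @ R)" "set K \<union> set R = set Q"
     "set L \<union> set R = set U" "set M \<union> set R = set V"
    using S fg R Ker_subset[OF f] Ker_subset[OF g] by (auto simp: defs)
  have ty: "f \<in> Arr D" "Dom D f = K" "Cod D f = L" "g \<in> Arr D" "Dom D g = L" "Cod D g = M"
    using f g fg by (simp_all add: defs)
  have "(sel (M @ R) V \<cdot> (g \<otimes> Id D R) \<cdot> sel U (L @ R)) \<cdot>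
      (sel (L @ R) U \<cdot> (f \<otimes> Id D R) \<cdot> sel Q (K @ R)) =
      sel (M @ R) V \<cdot> (g \<otimes> Id D R) \<cdot> (f \<otimes> Id D R) \<cdot> sel Q (K @ R)"
    using sets ty by (simp add: sel_sel_left)
  also have "\<dots> = sel (M @ R) V \<cdot> ((g \<cdot> f) \<otimes> Id D R) \<cdot> sel Q (K @ R)"
    using sets ty by (simp add: interchange_left)
  finally show ?thesis
    by (simp add: whisker_def defs fg R)
qed

section \<open>Exchanging two whiskered kernels\<close>

lemma sel_whisker_whisker:
  assumes f: "f \<in> Ker D" and g: "g \<in> Ker D" and fg: "src D f \<inter> src D g = tgt D f \<inter> tgt D g"
    and P: "distinct P" "set P \<subseteq> src D f \<union> src D g"
  shows "sel (lst (tgt D f \<union> tgt D g)) (P @ lst (tgt D f) @ lst (tgt D g))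
      \<cdot> whisker g (tgt D f) \<cdot> whisker f (src D g) =
    (Id D P \<otimes> f \<otimes> g) \<cdot> sel (lst (src D f \<union> src D g)) (P @ lst (src D f) @ lst (src D g))"
proof -
  define K L K' L' Q R T where defs: "K = lst (src D f)" "L = lst (tgt D f)"
    "K' = lst (src D g)" "L' = lst (tgt D g)" "Q = lst (src D f \<union> src D g)"
    "R = lst (tgt D f \<union> src D g)" "T = lst (tgt D f \<union> tgt D g)"
  have sets: "distinct P" "set P \<subseteq> set Q" "set Q = set K \<union> set K'" "set R = set L \<union> set K'"
    "set K \<subseteq> set L" "set T = set L \<union> set L'" "set K' \<subseteq> set L'" "set P \<subseteq> set R" "set P \<subseteq> set T"
    "set L \<subseteq> set R" "distinct K'" "distinct L"
    using P Ker_subset[OF f] Ker_subset[OF g] by (auto simp: defs)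
  have fresh: "fresh_for (src D g) f" "fresh_for (tgt D f) g"
    using fg Ker_subset[OF f] Ker_subset[OF g] by (auto simp: fresh_for_def)
  let ?w = "whisker f (src D g)" and ?w' = "whisker g (tgt D f)"
  have ty: "f \<in> Arr D" "Dom D f = K" "Cod D f = L" "g \<in> Arr D" "Dom D g = K'" "Cod D g = L'"
    "?w \<in> Arr D" "Dom D ?w = Q" "Cod D ?w = R" "?w' \<in> Arr D" "Dom D ?w' = R" "Cod D ?w' = T"
    using f g by (simp_all add: defs Un_commute)
  have "sel T (P @ L @ L') \<cdot> ?w' = (Id D (P @ L) \<otimes> g) \<cdot> sel R (P @ L @ K')"
    using sel_whisker[OF g fresh(2), of "P @ L"] P Ker_subset[OF f] sets
    by (simp add: defs Un_commute)
  \<comment> \<open>The block produced by \<open>f\<close> is moved to the end, the position from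
    which \<open>sel_whisker\<close> pulls out \<open>f\<close>.\<close>
  also have "sel R (P @ L @ K') = (Id D P \<otimes> Sym D K' L) \<cdot> sel R (P @ K' @ L)"
    using sets by (simp add: sel_swap)
  finally have "sel T (P @ L @ L') \<cdot> ?w' \<cdot> ?w =
      (Id D (P @ L) \<otimes> g) \<cdot> (Id D P \<otimes> Sym D K' L) \<cdot> (sel R ((P @ K') @ L) \<cdot> ?w)"
    using sets ty by (simp flip: Comp_assoc')
  also have "sel R ((P @ K') @ L) \<cdot> ?w = (Id D (P @ K') \<otimes> f) \<cdot> sel Q (P @ K' @ K)"
    using sel_whisker[OF f fresh(1), of "P @ K'"] P by (simp add: defs)
  also have "(Id D (P @ L) \<otimes> g) \<cdot> (Id D P \<otimes> Sym D K' L) \<cdot> \<dots> =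
      (Id D P \<otimes> (Id D L \<otimes> g)) \<cdot> (Id D P \<otimes> Sym D K' L) \<cdot> (Id D P \<otimes> (Id D K' \<otimes> f)) \<cdot> sel Q (P @ K' @ K)"
    using ty by (simp flip: Tens_Id')
  also have "\<dots> = (Id D P \<otimes> ((Id D L \<otimes> g) \<cdot> (f \<otimes> Id D K') \<cdot> Sym D K' K)) \<cdot> sel Q (P @ K' @ K)"
    using ty sets by (simp add: interchange_left Sym_natural' del: Tens_assoc)
  also have "(Id D L \<otimes> g) \<cdot> (f \<otimes> Id D K') \<cdot> Sym D K' K = (f \<otimes> g) \<cdot> Sym D K' K"
    using ty by (simp add: interchange_left)
  also have "(Id D P \<otimes> ((f \<otimes> g) \<cdot> Sym D K' K)) \<cdot> sel Q (P @ K' @ K) =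
      (Id D P \<otimes> (f \<otimes> g)) \<cdot> (Id D P \<otimes> Sym D K' K) \<cdot> sel Q (P @ K' @ K)"
    using ty sets by (subst interchange_left) auto
  also have "(Id D P \<otimes> Sym D K' K) \<cdot> sel Q (P @ K' @ K) = sel Q (P @ K @ K')"
    using sets by (simp add: sel_swap)
  finally show ?thesis by (simp only: defs)
qed

text \<open>By \<open>sel_whisker_whisker\<close> both composites agree, up to swapping blocks, once
  the input and both outputs are read off separately; this reading loses nothing.\<close>

lemma whisker_commute:
  assumes f: "f \<in> Ker D" and g: "g \<in> Ker D" and fg: "src D f \<inter> src D g = tgt D f \<inter> tgt D g"
  shows "whisker g (tgt D f) \<cdot> whisker f (src D g) = whisker f (tgt D g) \<cdot> whisker g (src D f)"
proof -
  define K L K' L' P T where defs: "K = lst (src D f)" "L = lst (tgt D f)"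
    "K' = lst (src D g)" "L' = lst (tgt D g)" "P = lst (src D f \<union> src D g)"
    "T = lst (tgt D f \<union> tgt D g)"
  let ?l = "whisker g (tgt D f) \<cdot> whisker f (src D g)"
    and ?r = "whisker f (tgt D g) \<cdot> whisker g (src D f)"
  have sets: "distinct P" "set P = set K \<union> set K'" "set T = set L \<union> set L'" "set P \<subseteq> set T"
    "distinct T"
    using Ker_subset[OF f] Ker_subset[OF g] by (auto simp: defs)
  have ty: "f \<in> Arr D" "Dom D f = K" "Cod D f = L" "g \<in> Arr D" "Dom D g = K'" "Cod D g = L'"
    "?l \<in> Arr D" "Cod D ?l = T" "?r \<in> Arr D" "Cod D ?r = T"
    using f g by (simp_all add: defs Un_commute)
  have l: "sel T (P @ L @ L') \<cdot> ?l = (Id D P \<otimes> f \<otimes> g) \<cdot> sel P (P @ K @ K')"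
    using sel_whisker_whisker[OF f g fg, of P] by (simp add: defs)
  have "sel T (P @ L @ L') = (Id D P \<otimes> Sym D L' L) \<cdot> sel T (P @ L' @ L)"
    using sets by (simp add: sel_swap)
  then have "sel T (P @ L @ L') \<cdot> ?r = (Id D P \<otimes> Sym D L' L) \<cdot> (sel T (P @ L' @ L) \<cdot> ?r)"
    using sets ty by (simp only: Comp_assoc') simp
  also have "\<dots> = (Id D P \<otimes> Sym D L' L) \<cdot> (Id D P \<otimes> (g \<otimes> f)) \<cdot> sel P (P @ K' @ K)"
    using sel_whisker_whisker[OF g f, of P] fg by (simp add: defs Int_commute Un_commute)
  also have "\<dots> = (Id D P \<otimes> (f \<otimes> g)) \<cdot> (Id D P \<otimes> Sym D K' K) \<cdot> sel P (P @ K' @ K)"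
    using sets ty by (simp add: interchange_left Sym_natural' del: Tens_assoc)
  also have "\<dots> = sel T (P @ L @ L') \<cdot> ?l"
    using sets by (simp add: sel_swap l)
  finally have "sel (P @ L @ L') T \<cdot> sel T (P @ L @ L') \<cdot> ?l =
      sel (P @ L @ L') T \<cdot> sel T (P @ L @ L') \<cdot> ?r"
    by (simp only:)
  \<comment> \<open>\<open>sel (P @ L @ L') T\<close> is a left inverse of \<open>sel T (P @ L @ L')\<close>.\<close>
  then show ?thesis
    using sets ty by (subst (asm) (1 2) sel_sel_left) auto
qed

section \<open>Parallel composition and subkernels\<close>

definition compatible :: "'m \<Rightarrow> 'm \<Rightarrow> bool" where
  "compatible f g \<longleftrightarrow> src D f \<inter> src D g = tgt D f \<inter> tgt D g"

definition parallel :: "'m \<Rightarrow> 'm \<Rightarrow> 'm" where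
  "parallel f g = whisker g (tgt D f) \<cdot> whisker f (src D g)"

text \<open>\<open>sel_whisker_whisker\<close> with \<open>P = N\<close> relates the defining
  diagram to \<open>parallel f g\<close>: what precedes \<open>f \<otimes> g\<close> is a single
  selection, and what follows reassembles the target.\<close>

lemma par_comp_eq:
  assumes f: "f \<in> Ker D" and g: "g \<in> Ker D"
  shows "par_comp D f g = (if compatible f g then Some (parallel f g) else None)"
proof (cases "compatible f g")
  case False
  then show ?thesis by (simp add: par_comp_def compatible_def Let_def)
next
  case True
  then have fg: "src D f \<inter> src D g = tgt D f \<inter> tgt D g" by (simp add: compatible_def)
  define X Y U V where sets_defs: "X = src D f" "Y = tgt D f" "U = src D g" "V = tgt D g"
  define L L1 L2 A B N Q T where list_defs: "L = lst (X \<inter> U)" "L1 = lst (X - U)" "L2 = lst (U - X)"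
    "A = lst (Y - X)" "B = lst (V - U)" "N = L1 @ L @ L2" "Q = lst (X \<union> U)" "T = lst (Y \<union> V)"
  have XY: "finite X" "finite Y" "finite U" "finite V" "X \<subseteq> Y" "U \<subseteq> V" "X \<inter> U = Y \<inter> V"
    using fg Ker_subset[OF f] Ker_subset[OF g] by (simp_all add: sets_defs)
  have sets: "set L = X \<inter> U" "set L1 = X - U" "set L2 = U - X" "set A = Y - X" "set B = V - U"
    "set N = X \<union> U" "set Q = X \<union> U" "set T = Y \<union> V"
    using XY by (auto simp: list_defs)
  have dist: "distinct L" "distinct L1" "distinct L2" "distinct N" "distinct (N @ A @ B)"
    "distinct Q" "distinct T"
    using XY by (auto simp: list_defs)
  have ty: "f \<in> Arr D" "Dom D f = lst X" "Cod D f = lst Y" "g \<in> Arr D" "Dom D g = lst U"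
    "Cod D g = lst V"
    using f g by (simp_all add: sets_defs)
  let ?w = "parallel f g" and ?f = "sel (lst Y) A \<cdot> f" and ?g = "sel (lst V) B \<cdot> g"
  let ?s1 = "sel Q N" and ?r1 = "sel (L1 @ L) (lst X)" and ?r2 = "sel (L @ L2) (lst U)"
    and ?s2 = "sel (N @ A @ B) T"
  have w: "?w \<in> Arr D" "Cod D ?w = T"
    using f g by (simp_all add: parallel_def sets_defs list_defs Un_commute)
  have cods: "Cod D ?r1 = lst X" "Cod D ?r2 = lst U" "Cod D (sel (lst Y) A) = A"
      "Cod D (sel (lst V) B) = B" "Cod D (sel Q (N @ L1 @ L @ L @ L2)) = N @ L1 @ L @ L @ L2"
      "Cod D (sel T (N @ lst Y @ lst V)) = N @ lst Y @ lst V"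
    using sets XY by (auto intro!: Cod_sel)
  have rewires: "rewire D Q N = ?s1" "rewire D (L1 @ L) (lst X) = ?r1"
    "rewire D (L @ L2) (lst U) = ?r2" "rewire D (N @ A @ B) T = ?s2"
    using XY sets dist by (auto intro!: rewire_eq_sel simp: list_defs)
  have "Id D L1 \<otimes> Copy D L \<otimes> Id D L2 = sel L1 L1 \<otimes> sel L (L @ L) \<otimes> sel L2 L2"
    using dist by (simp add: Copy_eq_sel)
  also have "sel L (L @ L) \<otimes> sel L2 L2 = sel (L @ L2) ((L @ L) @ L2)"
    using dist sets by (intro sel_Tens) auto
  also have "sel L1 L1 \<otimes> \<dots> = sel N (L1 @ (L @ L) @ L2)"
    unfolding list_defs(6) using dist sets by (intro sel_Tens) auto
  finally have "(Id D N \<otimes> (Id D L1 \<otimes> Copy D L \<otimes> Id D L2)) \<cdot> Copy D N =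
      (sel N N \<otimes> sel N (L1 @ (L @ L) @ L2)) \<cdot> sel N (N @ N)"
    using dist by (simp add: Copy_eq_sel)
  also have "\<dots> = sel N (N @ L1 @ (L @ L) @ L2)"
    using dist sets by (intro sel_Tens_sel) auto
  finally have "((Id D N \<otimes> (Id D L1 \<otimes> Copy D L \<otimes> Id D L2)) \<cdot> Copy D N) \<cdot> ?s1 =
      sel N (N @ L1 @ (L @ L) @ L2) \<cdot> ?s1"
    by (rule arg_cong)
  also have "\<dots> = sel Q (N @ L1 @ (L @ L) @ L2)"
    using sets by (intro sel_sel) auto
  finally have "(Id D N \<otimes> Id D L1 \<otimes> Copy D L \<otimes> Id D L2) \<cdot> Copy D N \<cdot> ?s1 =
      sel Q (N @ (L1 @ L) @ (L @ L2))"
    using sets dist by (simp add: list_defs(6))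
  moreover have "Id D N \<otimes> (?f \<cdot> ?r1) \<otimes> (?g \<cdot> ?r2) =
      (Id D N \<otimes> sel (lst Y) A \<otimes> sel (lst V) B) \<cdot> (Id D N \<otimes> f \<otimes> g) \<cdot> (Id D N \<otimes> ?r1 \<otimes> ?r2)"
    using ty cods by (simp add: interchange)
  ultimately have "(Id D N \<otimes> (?f \<cdot> ?r1) \<otimes> (?g \<cdot> ?r2)) \<cdot> (Id D N \<otimes> Id D L1 \<otimes> Copy D L \<otimes> Id D L2)
      \<cdot> Copy D N \<cdot> ?s1 =
      (Id D N \<otimes> sel (lst Y) A \<otimes> sel (lst V) B) \<cdot> (Id D N \<otimes> f \<otimes> g)
      \<cdot> ((sel N N \<otimes> ?r1 \<otimes> ?r2) \<cdot> sel Q (N @ (L1 @ L) @ (L @ L2)))"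
    using ty cods dist by simp
  also have "(sel N N \<otimes> ?r1 \<otimes> ?r2) \<cdot> sel Q (N @ (L1 @ L) @ (L @ L2)) = sel Q (N @ lst X @ lst U)"
    using sets XY by (intro sel_Tens_sel3) auto
  \<comment> \<open>The two kernels run beside a copy of the input are traded for reading the input
    and both outputs off the parallel composite.\<close>
  also have "(Id D N \<otimes> f \<otimes> g) \<cdot> \<dots> = sel T (N @ lst Y @ lst V) \<cdot> ?w"
    using sel_whisker_whisker[OF f g fg, of N] sets dist
    by (simp add: parallel_def sets_defs list_defs(7,8))
  also have "(Id D N \<otimes> sel (lst Y) A \<otimes> sel (lst V) B) \<cdot> \<dots> =
      ((sel N N \<otimes> sel (lst Y) A \<otimes> sel (lst V) B) \<cdot> sel T (N @ lst Y @ lst V)) \<cdot> ?w"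
    using w cods dist by simp
  also have "(sel N N \<otimes> sel (lst Y) A \<otimes> sel (lst V) B) \<cdot> sel T (N @ lst Y @ lst V) = sel T (N @ A @ B)"
    using sets XY by (intro sel_Tens_sel3) auto
  finally have "?s2 \<cdot> (Id D N \<otimes> (?f \<cdot> ?r1) \<otimes> (?g \<cdot> ?r2))
      \<cdot> (Id D N \<otimes> Id D L1 \<otimes> Copy D L \<otimes> Id D L2) \<cdot> Copy D N \<cdot> ?s1 = ?s2 \<cdot> sel T (N @ A @ B) \<cdot> ?w"
    by (rule arg_cong)
  \<comment> \<open>\<open>N\<close>, \<open>A\<close> and \<open>B\<close> together contain every
    target variable, so the selections cancel.\<close>
  also have "\<dots> = sel T T \<cdot> ?w"
    using sets XY w by (intro sel_sel_left) auto
  also have "\<dots> = ?w"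
    using w dist by simp
  finally show ?thesis
    using True XY(7)
    unfolding par_comp_def Let_def nontrivial_part_eq[OF f] nontrivial_part_eq[OF g]
      sets_defs[symmetric] list_defs(1-5)[symmetric] list_defs(6-8)[symmetric] rewires
    by simp
qed

section \<open>Subkernels through whiskering\<close>

lemma subkernel_iff:
  "subkernel D f g \<longleftrightarrow> f \<in> Ker D \<and> g \<in> Ker D \<and>
    (\<exists>Z h. fresh_for Z f \<and> h \<in> Ker D \<and> src D h = tgt D f \<union> Z \<and> g = h \<cdot> whisker f Z)"
proof (cases "f \<in> Ker D")
  case f: True
  have rewires: "is_rewiring D (lst (src D f \<union> Z)) (lst (src D f) @ lst Z) s1 \<longleftrightarrow>
        s1 = sel (lst (src D f \<union> Z)) (lst (src D f) @ lst Z)"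
      "is_rewiring D (lst (tgt D f) @ lst Z) (lst (tgt D f \<union> Z)) s2 \<longleftrightarrow>
        s2 = sel (lst (tgt D f) @ lst Z) (lst (tgt D f \<union> Z))"
      "whisker f Z = sel (lst (tgt D f) @ lst Z) (lst (tgt D f \<union> Z)) \<cdot> (f \<otimes> Id D (lst Z))
        \<cdot> sel (lst (src D f \<union> Z)) (lst (src D f) @ lst Z)"
    if "finite Z" "Z \<inter> tgt D f = {}" for Z s1 s2
  proof -
    have "Z \<inter> src D f = {}" "src D f \<inter> Z = {}" "tgt D f \<inter> Z = {}"
      using that Ker_subset[OF f] by auto
    then show "is_rewiring D (lst (src D f \<union> Z)) (lst (src D f) @ lst Z) s1 \<longleftrightarrow>
        s1 = sel (lst (src D f \<union> Z)) (lst (src D f) @ lst Z)"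
      "is_rewiring D (lst (tgt D f) @ lst Z) (lst (tgt D f \<union> Z)) s2 \<longleftrightarrow>
        s2 = sel (lst (tgt D f) @ lst Z) (lst (tgt D f \<union> Z))"
      "whisker f Z = sel (lst (tgt D f) @ lst Z) (lst (tgt D f \<union> Z)) \<cdot> (f \<otimes> Id D (lst Z))
        \<cdot> sel (lst (src D f \<union> Z)) (lst (src D f) @ lst Z)"
      using that by (simp_all add: is_rewiring_iff whisker_def Diff_triv)
  qed
  have "subkernel D f g \<longleftrightarrow> g \<in> Ker D \<and> (\<exists>Z h. finite Z \<and> Z \<inter> tgt D f = {} \<and> h \<in> Ker D \<and>
      src D h = tgt D f \<union> Z \<and> g = h \<cdot> whisker f Z)"
    using f rewires unfolding subkernel_def by (simp cong: conj_cong)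
  also have "\<dots> \<longleftrightarrow> g \<in> Ker D \<and> (\<exists>Z h. fresh_for Z f \<and> h \<in> Ker D \<and>
      src D h = tgt D f \<union> Z \<and> g = h \<cdot> whisker f Z)"
  proof -
    \<comment> \<open>A fresh \<open>Z\<close> may contain inputs of \<open>f\<close>. Removing them
      yields a set disjoint from the target and alters neither the source of \<open>h\<close> nor
      the whiskering.\<close>
    have "finite (Z - src D f) \<and> (Z - src D f) \<inter> tgt D f = {} \<and>
        tgt D f \<union> Z = tgt D f \<union> (Z - src D f) \<and> whisker f Z = whisker f (Z - src D f)"
      if "fresh_for Z f" for Z
    proof -
      have *: "tgt D f \<union> (Z - src D f) = tgt D f \<union> Z"
        using Ker_subset[OF f] by auto
      then show ?thesis using that by (auto simp: fresh_for_def whisker_def *)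
    qed
    moreover have "finite Z \<Longrightarrow> Z \<inter> tgt D f = {} \<Longrightarrow> fresh_for Z f" for Z
      by (auto simp: fresh_for_def)
    ultimately show ?thesis by metis
  qed
  finally show ?thesis using f by blast
qed (simp add: subkernel_def)

section \<open>Laws of parallel composition\<close>

lemma compatible_fresh:
  assumes "f \<in> Ker D" "g \<in> Ker D" "compatible f g"
  shows "fresh_for (src D g) f" "fresh_for (tgt D g) f" "fresh_for (src D f) g" "fresh_for (tgt D f) g"
  using assms Ker_subset[of f] Ker_subset[of g] by (auto simp: compatible_def fresh_for_def)

lemma parallel_Ker [simp]:
  assumes "f \<in> Ker D" "g \<in> Ker D" "compatible f g"
  shows "parallel f g \<in> Ker D"
  using assms compatible_fresh[OF assms] by (auto simp: parallel_def intro!: Comp_Ker)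

lemma src_parallel [simp]: "f \<in> Ker D \<Longrightarrow> src D (parallel f g) = src D f \<union> src D g"
  and tgt_parallel [simp]: "g \<in> Ker D \<Longrightarrow> tgt D (parallel f g) = tgt D f \<union> tgt D g"
  by (auto simp: parallel_def)

lemma whisker_parallel:
  assumes f: "f \<in> Ker D" and g: "g \<in> Ker D" and fg: "compatible f g"
    and S: "fresh_for S f" "fresh_for S g"
  shows "whisker (parallel f g) S = whisker g (tgt D f \<union> S) \<cdot> whisker f (src D g \<union> S)"
proof -
  note fresh = compatible_fresh[OF f g fg]
  have "whisker (parallel f g) S = whisker (whisker g (tgt D f)) S \<cdot> whisker (whisker f (src D g)) S"
    unfolding parallel_def using f g fresh S Ker_subset[OF f]
    by (intro whisker_Comp) (auto simp: fresh_for_def)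
  then show ?thesis
    using f g fresh S by (simp add: whisker_whisker)
qed

lemma parallel_commute:
  "f \<in> Ker D \<Longrightarrow> g \<in> Ker D \<Longrightarrow> compatible f g \<Longrightarrow> parallel f g = parallel g f"
  by (simp add: parallel_def compatible_def whisker_commute)

text \<open>Functoriality splits the composite into four whiskered kernels, of which the middle two,
  from \<open>a2\<close> and \<open>b1\<close>, are exchanged by
  \<open>whisker_commute\<close>.\<close>

lemma parallel_exchange:
  assumes ker: "a1 \<in> Ker D" "a2 \<in> Ker D" "b1 \<in> Ker D" "b2 \<in> Ker D"
    and a: "tgt D a1 = src D a2" and b: "tgt D b1 = src D b2"
    and ab: "compatible (a2 \<cdot> a1) (b2 \<cdot> b1)"
  shows "parallel (a2 \<cdot> a1) (b2 \<cdot> b1) = parallel a2 b2 \<cdot> parallel a1 b1"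
proof -
  note sub = ker[THEN Ker_subset]
  \<comment> \<open>By compatibility a variable common to the final targets is already in both
    initial sources; with the inclusions \<open>sub\<close> this settles the overlaps of all
    intermediate sets.\<close>
  have ab': "tgt D a2 \<inter> tgt D b2 \<subseteq> src D a1" "tgt D a2 \<inter> tgt D b2 \<subseteq> src D b1"
    using ab by (auto simp: compatible_def)
  have fresh: "fresh_for (src D b1) a1" "fresh_for (src D b1) a2" "fresh_for (tgt D a2) b1"
    "fresh_for (tgt D a2) b2" "fresh_for (tgt D a1) b1" "fresh_for (tgt D b1) a2"
    and S: "src D b1 \<inter> tgt D a2 \<subseteq> src D a1" "tgt D a2 \<inter> tgt D b2 \<subseteq> src D b1"
    and compat: "src D a2 \<inter> src D b1 = tgt D a2 \<inter> tgt D b1"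
    using sub ab' unfolding fresh_for_def a b by simp_all blast+
  have "parallel (a2 \<cdot> a1) (b2 \<cdot> b1) =
      (whisker b2 (tgt D a2) \<cdot> whisker b1 (tgt D a2)) \<cdot> (whisker a2 (src D b1) \<cdot> whisker a1 (src D b1))"
    using ker a b S by (simp add: parallel_def whisker_Comp)
  also have "\<dots> = whisker b2 (tgt D a2) \<cdot> (whisker b1 (tgt D a2) \<cdot> whisker a2 (src D b1))
      \<cdot> whisker a1 (src D b1)"
    using ker a b by (simp add: Un_commute)
  also have "whisker b1 (tgt D a2) \<cdot> whisker a2 (src D b1) =
      whisker a2 (tgt D b1) \<cdot> whisker b1 (src D a2)"
    using ker compat by (intro whisker_commute)
  also have "whisker b2 (tgt D a2) \<cdot> \<dots> \<cdot> whisker a1 (src D b1) = parallel a2 b2 \<cdot> parallel a1 b1"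
    using ker a b by (simp add: parallel_def Un_commute)
  finally show ?thesis .
qed

text \<open>Both bracketings unfold to whiskerings of \<open>f\<close>, then \<open>g\<close>, then
  \<open>h\<close>, with the same adjoined sets.\<close>

lemma parallel_assoc:
  assumes ker: "f \<in> Ker D" "g \<in> Ker D" "h \<in> Ker D"
    and fg: "compatible f g" and gh: "compatible g h" and fh: "compatible f h"
  shows "parallel (parallel f g) h = parallel f (parallel g h)"
proof -
  note sub = ker[THEN Ker_subset]
  note fresh = compatible_fresh[OF ker(1,2) fg] compatible_fresh[OF ker(2,3) gh]
    compatible_fresh[OF ker(1,3) fh]
  have "parallel (parallel f g) h = whisker h (tgt D f \<union> tgt D g)
      \<cdot> whisker g (tgt D f \<union> src D h) \<cdot> whisker f (src D g \<union> src D h)"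
    using ker fg fresh by (simp add: parallel_def[of "parallel f g"] whisker_parallel)
  moreover have "parallel f (parallel g h) = (whisker h (tgt D g \<union> tgt D f)
      \<cdot> whisker g (src D h \<union> tgt D f)) \<cdot> whisker f (src D g \<union> src D h)"
    using ker gh fresh by (simp add: parallel_def[of f "parallel g h"] whisker_parallel)
  ultimately show ?thesis using ker by (simp add: Un_ac)
qed

text \<open>Pairwise compatibility is a criterion common to both bracketings, so they are defined
  together.\<close>

lemma compatible_parallel:
  assumes "f \<in> Ker D" "g \<in> Ker D" "h \<in> Ker D"
  shows "compatible f g \<and> compatible (parallel f g) h \<longleftrightarrow>
      compatible f g \<and> compatible g h \<and> compatible f h"
    and "compatible g h \<and> compatible f (parallel g h) \<longleftrightarrow>
      compatible f g \<and> compatible g h \<and> compatible f h"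
  unfolding compatible_def src_parallel[OF assms(1)] src_parallel[OF assms(2)]
    tgt_parallel[OF assms(2)] tgt_parallel[OF assms(3)]
  using assms[THEN Ker_subset] by blast+

section \<open>Order properties of subkernels\<close>

lemma subkernel_refl: "f \<in> Ker D \<Longrightarrow> subkernel D f f"
  unfolding subkernel_iff
  by (intro conjI exI[of _ "{}"] exI[of _ "Id D (lst (tgt D f))"])
    (simp_all add: fresh_for_def whisker_absorb)

lemma subkernelE:
  assumes "subkernel D f g"
  obtains Z h where "f \<in> Ker D" "h \<in> Ker D" "fresh_for Z f" "finite Z" "src D h = tgt D f \<union> Z"
    "g = h \<cdot> whisker f Z"
  using assms unfolding subkernel_iff by (auto simp: fresh_for_def)

lemma subkernelI:
  assumes "f \<in> Ker D" "h \<in> Ker D" "fresh_for Z f" "src D h = tgt D f \<union> Z"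
  shows "subkernel D f (h \<cdot> whisker f Z)"
  using assms unfolding subkernel_iff by (auto simp: fresh_for_def intro!: Comp_Ker)

lemma subkernel_trans:
  assumes "subkernel D a b" "subkernel D b c"
  shows "subkernel D a c"
proof -
  obtain Z h where a: "a \<in> Ker D" and h: "h \<in> Ker D" and Z: "fresh_for Z a" "finite Z"
    and src_h: "src D h = tgt D a \<union> Z" and b: "b = h \<cdot> whisker a Z"
    using assms(1) by (rule subkernelE)
  obtain Z' k where "b \<in> Ker D" and k: "k \<in> Ker D" and Z': "fresh_for Z' b" "finite Z'"
    and src_k: "src D k = tgt D b \<union> Z'" and c: "c = k \<cdot> whisker b Z'"
    using assms(2) by (rule subkernelE)
  have fresh: "Z' \<inter> tgt D h \<subseteq> src D a \<union> Z" "fresh_for Z' a" "fresh_for Z' h" "fresh_for (Z \<union> Z') a"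
    using a Z Z' src_h Ker_subset[OF h] Ker_subset[OF a] by (auto simp: fresh_for_def b)
  \<comment> \<open>Distributing \<open>Z'\<close> over \<open>b\<close> shows the witnesses for
    \<open>a\<close>: the set \<open>Z \<union> Z'\<close> and the kernel \<open>k\<close> after
    \<open>h\<close> whiskered by \<open>Z'\<close>.\<close>
  have "c = k \<cdot> whisker h Z' \<cdot> whisker (whisker a Z) Z'"
    using a h Z Z' fresh src_h by (simp add: c b whisker_Comp)
  also have "\<dots> = (k \<cdot> whisker h Z') \<cdot> whisker a (Z \<union> Z')"
    using a h k Z Z' fresh src_h src_k by (simp add: whisker_whisker b Un_assoc)
  finally show ?thesis
    using a h k Z' fresh src_h src_k
    by (auto simp: b Un_assoc intro!: subkernelI Comp_Ker)
qed

text \<open>\<open>parallel_exchange\<close> splits off the whiskered parts, which combine into one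
  whiskering of \<open>parallel a' b'\<close>; the witnesses are \<open>Z \<union> Z'\<close> and
  \<open>parallel h k\<close>.\<close>

lemma parallel_mono:
  assumes ker: "a \<in> Ker D" "b \<in> Ker D" and ab: "compatible a b"
    and a: "subkernel D a' a" and b: "subkernel D b' b"
  shows "compatible a' b' \<and> subkernel D (parallel a' b') (parallel a b)"
proof -
  obtain Z h where a': "a' \<in> Ker D" and h: "h \<in> Ker D" and Z: "fresh_for Z a'" "finite Z"
    and src_h: "src D h = tgt D a' \<union> Z" and a_eq: "a = h \<cdot> whisker a' Z"
    using a by (rule subkernelE)
  obtain Z' k where b': "b' \<in> Ker D" and k: "k \<in> Ker D" and Z': "fresh_for Z' b'" "finite Z'"
    and src_k: "src D k = tgt D b' \<union> Z'" and b_eq: "b = k \<cdot> whisker b' Z'"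
    using b by (rule subkernelE)
  note sub = Ker_subset[OF a'] Ker_subset[OF b'] Ker_subset[OF h] Ker_subset[OF k]
  have ab': "tgt D h \<inter> tgt D k \<subseteq> src D a' \<union> Z" "tgt D h \<inter> tgt D k \<subseteq> src D b' \<union> Z'"
    "(src D a' \<union> Z) \<inter> (src D b' \<union> Z') \<subseteq> tgt D h \<inter> tgt D k"
    using ab a' b' Z Z' by (auto simp: compatible_def a_eq b_eq)
  have le: "tgt D a' \<subseteq> tgt D h" "Z \<subseteq> tgt D h" "tgt D b' \<subseteq> tgt D k" "Z' \<subseteq> tgt D k"
    "Z \<inter> tgt D a' \<subseteq> src D a'" "Z' \<inter> tgt D b' \<subseteq> src D b'"
    using sub src_h src_k Z Z' by (auto simp: fresh_for_def)
  have compat: "compatible a' b'"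
    using sub(1,2) le ab'(1,2) unfolding compatible_def by blast
  have hk: "compatible h k"
    using le ab' sub unfolding compatible_def src_h src_k by blast
  have fresh: "fresh_for (Z \<union> Z') a'" "fresh_for (Z \<union> Z') b'"
    "fresh_for (tgt D a' \<union> Z) b'" "fresh_for (src D b' \<union> Z') a'"
    using le ab'(1,2) sub(1,2) Z(2) Z'(2) finite_src finite_tgt unfolding fresh_for_def finite_Un
    by blast+
  have "parallel a b = parallel h k \<cdot> parallel (whisker a' Z) (whisker b' Z')"
    using ab a' b' h k Z Z' src_h src_k unfolding a_eq b_eq by (intro parallel_exchange) auto
  also have "parallel (whisker a' Z) (whisker b' Z') = whisker (parallel a' b') (Z \<union> Z')"
    using a' b' Z Z' compat fresh
    by (simp add: parallel_def[of "whisker a' Z"] whisker_parallel whisker_whisker Un_ac)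
  finally have "parallel a b = parallel h k \<cdot> whisker (parallel a' b') (Z \<union> Z')" .
  moreover have "subkernel D (parallel a' b') (parallel h k \<cdot> whisker (parallel a' b') (Z \<union> Z'))"
    using a' b' h k hk compat fresh src_h src_k
    by (intro subkernelI) (auto simp: fresh_for_def)
  ultimately show ?thesis using compat by simp
qed

text \<open>Whiskering distributes over the composite, so \<open>c\<close> is \<open>h\<close> after
  the whiskerings of \<open>b\<close> and \<open>a\<close>; the whiskering of \<open>a\<close>
  serves as \<open>a'\<close> and the rest as \<open>b'\<close>.\<close>

lemma seq_comp_up_closed:
  assumes a: "a \<in> Ker D" and b: "b \<in> Ker D" and ab: "tgt D a = src D b"
    and sub: "subkernel D (b \<cdot> a) c"
  shows "\<exists>a'\<in>Ker D. \<exists>b'\<in>Ker D. subkernel D a a' \<and> subkernel D b b' \<and> seq_comp D a' b' = Some c"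
proof -
  obtain Z h where h: "h \<in> Ker D" and Z: "fresh_for Z (b \<cdot> a)" "finite Z"
    and src_h: "src D h = tgt D (b \<cdot> a) \<union> Z" and c: "c = h \<cdot> whisker (b \<cdot> a) Z"
    using sub by (rule subkernelE)
  have fresh: "fresh_for Z a" "fresh_for Z b" "Z \<inter> tgt D b \<subseteq> src D a"
    using Z Ker_subset[OF a] Ker_subset[OF b] ab by (auto simp: fresh_for_def)
  \<comment> \<open>Postcomposing with an identity kernel exhibits \<open>a\<close> as a subkernel
    of its own whiskering.\<close>
  have "subkernel D a (Id D (lst (tgt D a \<union> Z)) \<cdot> whisker a Z)"
    using a Z fresh by (intro subkernelI) simp_all
  then have "subkernel D a (whisker a Z)" using a Z by simp
  moreover have "subkernel D b (h \<cdot> whisker b Z)"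
    using b h fresh src_h by (intro subkernelI) simp_all
  moreover have "seq_comp D (whisker a Z) (h \<cdot> whisker b Z) = Some c"
    using a b h ab fresh Z src_h by (simp add: seq_comp_def c whisker_Comp)
  moreover have "h \<cdot> whisker b Z \<in> Ker D"
    using b h fresh Z src_h by (intro Comp_Ker) simp_all
  ultimately show ?thesis using a fresh whisker_Ker by blast
qed

section \<open>Verification of the frame axioms\<close>

theorem dibi_frame_Ker:
  "dibi_frame (Ker D) (subkernel D) (par_comp D) (seq_comp D) (Ker D)"
proof
  show "reflp_on (Ker D) (subkernel D)"
    by (simp add: reflp_on_def subkernel_refl)
  show "transp_on (Ker D) (subkernel D)"
    unfolding transp_on_def using subkernel_trans by blast
next
  fix a b c assume "a \<in> Ker D" "b \<in> Ker D" "par_comp D a b = Some c"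
  then show "c \<in> Ker D" by (auto simp: par_comp_eq split: if_splits)
next
  fix a b c assume "a \<in> Ker D" "b \<in> Ker D" "seq_comp D a b = Some c"
  then show "c \<in> Ker D" by (auto simp: seq_comp_def Comp_Ker split: if_splits)
next
  fix a b assume "a \<in> Ker D" "b \<in> Ker D"
  then show "par_comp D a b = par_comp D b a"
    by (auto simp: par_comp_eq parallel_commute) (auto simp: compatible_def Int_commute)
next
  fix a assume a: "a \<in> Ker D"
  have "Id D [] \<in> Ker D" using Id_Ker[of "{}"] by simp
  moreover from this a have "par_comp D (Id D []) a = Some a"
    using whisker_Id[of "{}" "src D a"]
    by (simp add: par_comp_eq compatible_def parallel_def whisker_absorb)
  ultimately show "\<exists>e\<in>Ker D. par_comp D e a = Some a" by blast
next
  fix a b c assume ker: "a \<in> Ker D" "b \<in> Ker D" "c \<in> Ker D"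
  show "lift_partial (par_comp D) (par_comp D a b) (Some c) =
      lift_partial (par_comp D) (Some a) (par_comp D b c)"
    using ker compatible_parallel[OF ker]
    by (auto simp: par_comp_eq lift_partial_def parallel_assoc)
next
  fix a assume "a \<in> Ker D"
  then have "seq_comp D (Id D (lst (src D a))) a = Some a" "seq_comp D a (Id D (lst (tgt D a))) = Some a"
    by (simp_all add: seq_comp_def)
  then show "\<exists>e\<in>Ker D. seq_comp D e a = Some a" "\<exists>e\<in>Ker D. seq_comp D a e = Some a"
    using Id_Ker by (meson finite_src finite_tgt)+
next
  fix a b c assume "a \<in> Ker D" "b \<in> Ker D" "c \<in> Ker D"
  then show "lift_partial (seq_comp D) (seq_comp D a b) (Some c) =
      lift_partial (seq_comp D) (Some a) (seq_comp D b c)"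
    by (simp add: seq_comp_def lift_partial_def)
next
  fix e a c assume "e \<in> Ker D" "a \<in> Ker D" "par_comp D a e = Some c"
  \<comment> \<open>The witnesses are the source of \<open>e\<close> as adjoined set and
    \<open>e\<close> whiskered by the target of \<open>a\<close>.\<close>
  then show "subkernel D a c"
    using compatible_fresh[of a e]
    by (auto simp: par_comp_eq parallel_def Un_commute split: if_splits intro!: subkernelI)
next
  fix e a c assume "e \<in> Ker D" "a \<in> Ker D" "seq_comp D a e = Some c"
  then show "subkernel D a c"
    using subkernelI[of a e "{}"]
    by (auto simp: seq_comp_def whisker_absorb fresh_for_def split: if_splits)
next
  fix a b a' b' c
  assume "a \<in> Ker D" "b \<in> Ker D" "a' \<in> Ker D" "b' \<in> Ker D" "par_comp D a b = Some c"
    "subkernel D a' a" "subkernel D b' b"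
  then show "\<exists>c'. par_comp D a' b' = Some c' \<and> subkernel D c' c"
    using parallel_mono[of a b a' b'] by (auto simp: par_comp_eq split: if_splits)
next
  fix a b c' c
  assume "a \<in> Ker D" "b \<in> Ker D" "c' \<in> Ker D" "seq_comp D a b = Some c" "subkernel D c c'"
  then show "\<exists>a'\<in>Ker D. \<exists>b'\<in>Ker D. subkernel D a a' \<and> subkernel D b b' \<and> seq_comp D a' b' = Some c'"
    using seq_comp_up_closed[of a b c'] by (auto simp: seq_comp_def[of D a b] split: if_splits)
next
  fix a1 a2 b1 b2
  assume ker: "a1 \<in> Ker D" "a2 \<in> Ker D" "b1 \<in> Ker D" "b2 \<in> Ker D"
    and "seq_comp D a1 a2 \<noteq> None" "seq_comp D b1 b2 \<noteq> None"
  then have a: "tgt D a1 = src D a2" and b: "tgt D b1 = src D b2"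
    by (auto simp: seq_comp_def split: if_splits)
  \<comment> \<open>The intersections of the sources, of the middle sets and of the targets
    increase, so the first equals the last iff both inclusions are equalities.\<close>
  have "compatible (a2 \<cdot> a1) (b2 \<cdot> b1) \<longleftrightarrow> compatible a1 b1 \<and> compatible a2 b2"
    using ker[THEN Ker_subset] unfolding compatible_def a b src_Comp tgt_Comp by blast
  then show "lift_partial (par_comp D) (seq_comp D a1 a2) (seq_comp D b1 b2) =
      lift_partial (seq_comp D) (par_comp D a1 b1) (par_comp D a2 b2)"
    using ker a b
    by (simp add: seq_comp_def lift_partial_def par_comp_eq Comp_Ker parallel_exchange)
qed simp_all

end

section \<open>The category of lists of variables is a Markov category\<close>

lemma tens_list_Obj:
  assumes "markov_category C" "\<And>x. \<theta> x \<in> Obj C"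
  shows "tens_list C \<theta> K \<in> Obj C"
proof -
  interpret markov_category C by fact
  show ?thesis by (induction K) (simp_all add: tens_list_def Unit_Obj TensObj_Obj assms)
qed

text \<open>Strictness makes the tensor over a concatenation literally the tensor of its parts, so
  the tagged tensor has the right endpoints.\<close>

lemma tens_list_append:
  assumes "markov_category C" "\<And>x. \<theta> x \<in> Obj C"
  shows "tens_list C \<theta> (K @ L) = TensObj C (tens_list C \<theta> K) (tens_list C \<theta> L)"
proof -
  interpret markov_category C by fact
  note Objs = tens_list_Obj[of C \<theta>, OF assms]
  show ?thesis
  proof (induction K)
    case Nil
    show ?case using Objs[of L] by (simp add: tens_list_def Unit_TensObj)
  next
    case (Cons x K)
    then show ?case
      using TensObj_assoc[OF assms(2) Objs Objs, of x K L] by (simp add: tens_list_def)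
  qed
qed

text \<open>Each law of the list category is the law of \<open>C\<close> on the underlying morphism;
  the objects match by \<open>tens_list_append\<close>.\<close>

lemma list_markov_category_var_category:
  assumes C: "markov_category C" and \<theta>: "\<And>x. \<theta> x \<in> Obj C"
  shows "list_markov_category (var_category C \<theta>)"
proof -
  interpret markov_category C by fact
  note Objs = tens_list_Obj[of C \<theta>, OF assms]
  note app = tens_list_append[of C \<theta>, OF assms]
  have nil: "tens_list C \<theta> [] = Unit C" by (simp add: tens_list_def)
  have Hom: "Hom (var_category C \<theta>) K L = {(K, L, f) | f. f \<in> Hom C (tens_list C \<theta> K) (tens_list C \<theta> L)}"
    for K L
    by (auto simp: Hom_def var_category_def)
  have Arr: "Arr (var_category C \<theta>) =
      {(K, L, f) | K L f. f \<in> Hom C (tens_list C \<theta> K) (tens_list C \<theta> L)}"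
    by (simp add: var_category_def)
  have HomArr: "f \<in> Hom C A B \<Longrightarrow> f \<in> Arr C" for f A B by (simp add: Hom_def)
  show ?thesis
  proof
    fix f assume "f \<in> Arr (var_category C \<theta>)"
    show "Dom (var_category C \<theta>) f \<in> Obj (var_category C \<theta>)"
      "Cod (var_category C \<theta>) f \<in> Obj (var_category C \<theta>)"
      by (simp_all add: var_category_def)
  qed (auto simp: Hom Arr, auto simp: var_category_def app nil Objs Id_Hom Comp_Hom Comp_Id
      Id_Comp Comp_assoc Tens_Hom Tens_Id Tens_Comp
      Tens_assoc Tens_Unit Unit_Tens Sym_Hom Sym_natural Sym_Sym Sym_hexagon Copy_Hom Del_Hom
      Copy_coassoc Copy_counit_left Copy_counit_right Copy_commute Copy_TensObj Del_TensObj
      Del_natural TensObj_Unit Unit_TensObj intro!: Tens_assoc Tens_Unit Unit_Tens intro: HomArr)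
qed

theorem theorem1:
  fixes C :: "('o, 'm) markov_data" and \<theta> :: "'v::linorder \<Rightarrow> 'o"
  assumes "countable (UNIV :: 'v set)" and "infinite (UNIV :: 'v set)"
    and "markov_category C"
    and "\<And>x. \<theta> x \<in> Obj C"
  shows "dibi_frame (Ker (var_category C \<theta>)) (subkernel (var_category C \<theta>))
    (par_comp (var_category C \<theta>)) (seq_comp (var_category C \<theta>)) (Ker (var_category C \<theta>))"
proof -
  interpret list_markov_category "var_category C \<theta>"
    using assms(3,4) by (rule list_markov_category_var_category)
  interpret kernel_category "var_category C \<theta>" ..
  show ?thesis by (rule dibi_frame_Ker)
qed

end
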